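(* Let $k, m, n$ be integers greater than $1$ such that $2^m \equiv 1 \pmod n$, and let $B(k,m,n)$ be the Bouwer graph defined in the context. Then $B(k,m,n)$ is arc-transitive if and only if $n = 3$, or $(k,n) = (2,5)$, or $(k,m,n) \in \{(2,3,7), (2,6,7), (2,6,21)\}$. Otherwise, $B(k,m,n)$ is half-arc-transitive. In particular, $B(k,m,n)$ is half-arc-transitive whenever $m > 6$ and $n > 5$.
   Context: For integers $k,m,n > 1$ with $2^m \equiv 1 \pmod n$ (so $n$ is odd and $2$ is a unit mod $n$, and $2^a$ mod $n$ is well defined for $a \in \mathbb{Z}_m$), the Bouwer graph $B(k,m,n)$ has vertex set $\mathbb{Z}_m \times (\mathbb{Z}_n)^{k-1}$; write a vertex as $(a,\mathbf{b})$ with $a \in \mathbb{Z}_m$, $\mathbf{b} \in (\mathbb{Z}_n)^{k-1}$. Let $\mathbf{e}_j$ ($1 \le j \le k-1$) denote the vector in $(\mathbb{Z}_n)^{k-1}$ with $j$th entry $1$ and all other entries $0$. Two vertices are adjacent if and only if they can be written as $(a,\mathbf{b})$ and $(a+1,\mathbf{c})$ where either $\mathbf{c} = \mathbf{b}$ or $\mathbf{c} = \mathbf{b} + 2^a \mathbf{e}_j$ for some $j \in \{1,\dots,k-1\}$. This is a simple $2k$-regular graph, and it is always vertex-transitive and edge-transitive. A graph is half-arc-transitive if it is vertex-transitive and edge-transitive but not arc-transitive. *)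

theory Defs
  imports "HOL-Library.FuncSet" "HOL-Number_Theory.Cong"
begin

text \<open>
  A simple graph is given by its vertex set \<open>V\<close> and its set \<open>E\<close> of edges, each edge being a
  two-element subset of \<open>V\<close>; an arc is an ordered pair \<open>(u, v)\<close> with \<open>{u, v} \<in> E\<close>.
\<close>

definition graph_automorphism :: "'a set \<Rightarrow> 'a set set \<Rightarrow> ('a \<Rightarrow> 'a) \<Rightarrow> bool" where
  "graph_automorphism V E f \<longleftrightarrow>
     bij_betw f V V \<and> (\<forall>u\<in>V. \<forall>v\<in>V. {u, v} \<in> E \<longleftrightarrow> {f u, f v} \<in> E)"

definition vertex_transitive :: "'a set \<Rightarrow> 'a set set \<Rightarrow> bool" where
  "vertex_transitive V E \<longleftrightarrow>
     (\<forall>u\<in>V. \<forall>v\<in>V. \<exists>f. graph_automorphism V E f \<and> f u = v)"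

definition edge_transitive :: "'a set \<Rightarrow> 'a set set \<Rightarrow> bool" where
  "edge_transitive V E \<longleftrightarrow>
     (\<forall>e\<in>E. \<forall>e'\<in>E. \<exists>f. graph_automorphism V E f \<and> f ` e = e')"

definition arcs :: "'a set \<Rightarrow> 'a set set \<Rightarrow> ('a \<times> 'a) set" where
  "arcs V E = {(u, v). u \<in> V \<and> v \<in> V \<and> {u, v} \<in> E}"

definition arc_transitive :: "'a set \<Rightarrow> 'a set set \<Rightarrow> bool" where
  "arc_transitive V E \<longleftrightarrow>
     (\<forall>(u, v)\<in>arcs V E. \<forall>(x, y)\<in>arcs V E.
        \<exists>f. graph_automorphism V E f \<and> f u = x \<and> f v = y)"

definition half_arc_transitive :: "'a set \<Rightarrow> 'a set set \<Rightarrow> bool" where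
  "half_arc_transitive V E \<longleftrightarrow>
     vertex_transitive V E \<and> edge_transitive V E \<and> \<not> arc_transitive V E"

text \<open>
  Residues are represented by their least nonnegative representatives, so \<open>\<int>\<^sub>m\<close> is \<open>{0..<m}\<close> and
  \<open>(\<int>\<^sub>n)\<^bsup>k-1\<^esup>\<close> consists of the extensional functions from \<open>{1..k-1}\<close> to \<open>{0..<n}\<close>. In the edge
  set \<open>a\<close> is such a representative; when \<open>2 ^ m \<equiv> 1\<close> modulo \<open>n\<close> this choice does not affect
  \<open>2 ^ a\<close> modulo \<open>n\<close>.
\<close>

definition unit_vector :: "nat \<Rightarrow> nat \<Rightarrow> nat" where
  "unit_vector j = (\<lambda>i. if i = j then 1 else 0)"

definition bouwer_vertices :: "nat \<Rightarrow> nat \<Rightarrow> nat \<Rightarrow> (nat \<times> (nat \<Rightarrow> nat)) set" where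
  "bouwer_vertices k m n = {0..<m} \<times> ({1..k-1} \<rightarrow>\<^sub>E {0..<n})"

definition bouwer_edges :: "nat \<Rightarrow> nat \<Rightarrow> nat \<Rightarrow> (nat \<times> (nat \<Rightarrow> nat)) set set" where
  "bouwer_edges k m n =
     {{(a, b), ((a + 1) mod m, c)} | a b c.
        (a, b) \<in> bouwer_vertices k m n \<and>
        (c = b \<or>
         (\<exists>j\<in>{1..k-1}. c = (\<lambda>i\<in>{1..k-1}. (b i + 2 ^ a * unit_vector j i) mod n)))}"

end

theory Submission
  imports Defs
begin

text \<open>
  Orient the edges from \<open>(a, b)\<close> to \<open>(a + 1, c)\<close> and call a step that adds \<open>\<pm>2 ^ a e\<^sub>j\<close> a step with
  label \<open>j\<close>, where \<open>e\<^sub>0 = 0\<close>. Translations, permutations of the labels and doubling act transitively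
  on the forward arcs, so the graph is arc-transitive if and only if some automorphism reverses an arc.

  Write \<open>U\<^sub>j\<close> and \<open>D\<^sub>j\<close> for forward and backward steps with label \<open>j\<close>. For \<open>i \<noteq> j\<close> the walk
  \<open>U\<^sub>i U\<^sub>j D\<^sub>i D\<^sub>j U\<^sub>i D\<^sub>j\<close> is closed, but a closed non-backtracking walk with the reversed pattern
  \<open>D D U U D U\<close> exists only if \<open>n = 3\<close> or \<open>n = 5\<close>, and for \<open>n = 5\<close> its first two steps have equal
  labels, which is impossible for all images at once if \<open>k > 2\<close>. It remains to see that an
  automorphism that reverses one arc reverses all arcs in sight, that is, that the partition of the
  neighbours of a vertex \<open>v\<close> into in- and out-neighbours is invariant. This follows by counting, for
  a path \<open>x, v, y\<close>, the neighbours \<open>p\<close> of \<open>y\<close> such that \<open>x, v, y, p\<close> lies on a closed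
  non-backtracking walk of length six: for directed and undirected paths the counts differ, up to
  finitely many values of \<open>(m, n)\<close> for which the threshold has to be adapted, and up to \<open>B(2,6,9)\<close>.
\<close>

section \<open>Automorphisms of finite graphs\<close>

text \<open>Which moduli are exceptional is decided by how signed powers of two can cancel at one
  label. In the closed walk of the overview the coefficients 1, 2, -2, -1, 1, -1 cancel label by
  label for every modulus. The reversed pattern, read from its lowest level, carries 1, 2, -2, 2,
  -2, -1; its 1 and -1 are adjacent and so have different labels, and for odd n > 3 the 1 can only
  be completed to 1 + 2 + 2 = 5. In the same way three up steps followed by three down steps close
  only through 1 + 2 + 4 = 7 once n is at least 7. The remaining special moduli come from walks that
  close because the level wraps around: a net change of 4 needs m = 4 and n dividing 15, a net
  change of 6 needs m = 3 or 6 and n dividing 7 or 63. Six up steps with m = 6 account for 9 = 1 + 8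
  and 21 = 1 + 4 + 16. The basic threshold is k, since every path that turns at its middle vertex
  has at least k admissible third steps, whereas a directed path usually has at most one.\<close>

lemma graph_automorphismI:
  assumes "finite V" and "E \<subseteq> Pow V" and inj: "inj_on f V" and sub: "f ` V \<subseteq> V"
    and pres: "\<And>e. e \<in> E \<Longrightarrow> f ` e \<in> E"
  shows "graph_automorphism V E f"
proof -
  have img: "f ` V = V"
    using endo_inj_surj[OF assms(1) sub inj] .
  have finE: "finite E"
    using assms(1,2) by (meson finite_Pow_iff finite_subset)
  have "inj_on ((`) f) (Pow V)"
    using inj by (rule inj_on_image_Pow)
  then have injE: "inj_on ((`) f) E"
    using assms(2) inj_on_subset by blast
  \<comment> \<open>An injective self-map of a finite edge set is onto, so edges are reflected as
    well as preserved.\<close>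
  have imgE: "(`) f ` E = E"
    using endo_inj_surj[OF finE _ injE] pres by blast
  have "{u, v} \<in> E" if uv: "u \<in> V" "v \<in> V" and fuv: "{f u, f v} \<in> E" for u v
  proof -
    have "f ` {u, v} \<in> (`) f ` E" using imgE fuv by simp
    then obtain e where e: "e \<in> E" "f ` e = f ` {u, v}" by (metis imageE)
    then have "e = {u, v}"
      using inj_on_image_eq_iff[OF inj, of e "{u, v}"] assms(2) uv by blast
    then show ?thesis using e by simp
  qed
  moreover have "{f u, f v} \<in> E" if "{u, v} \<in> E" for u v
    using pres[OF that] by simp
  ultimately show ?thesis
    unfolding graph_automorphism_def bij_betw_def using inj img by blast
qed

lemma graph_automorphism_comp:
  assumes "graph_automorphism V E f" "graph_automorphism V E g"
  shows "graph_automorphism V E (g \<circ> f)"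
proof -
  have "bij_betw (g \<circ> f) V V"
    using assms bij_betw_trans unfolding graph_automorphism_def by blast
  moreover have "f u \<in> V" if "u \<in> V" for u
    using assms(1) that bij_betw_apply unfolding graph_automorphism_def by metis
  ultimately show ?thesis
    using assms unfolding graph_automorphism_def by simp
qed

lemma graph_automorphism_in: "graph_automorphism V E f \<Longrightarrow> u \<in> V \<Longrightarrow> f u \<in> V"
  unfolding graph_automorphism_def using bij_betw_apply by metis

lemma graph_automorphism_inj:
  "graph_automorphism V E f \<Longrightarrow> u \<in> V \<Longrightarrow> v \<in> V \<Longrightarrow> f u = f v \<longleftrightarrow> u = v"
  unfolding graph_automorphism_def by (metis bij_betw_imp_inj_on inj_on_eq_iff)

lemma graph_automorphism_edge:
  "graph_automorphism V E f \<Longrightarrow> u \<in> V \<Longrightarrow> v \<in> V \<Longrightarrow> {f u, f v} \<in> E \<longleftrightarrow> {u, v} \<in> E"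
  unfolding graph_automorphism_def by blast

lemma graph_automorphism_surj:
  "graph_automorphism V E f \<Longrightarrow> w \<in> V \<Longrightarrow> \<exists>u\<in>V. w = f u"
  unfolding graph_automorphism_def bij_betw_def by blast

text \<open>
  Closed non-backtracking walks \<open>x, v, y, p, q, r\<close> take the place of 6-cycles: distinctness has to
  be checked at distance two only, and the case \<open>m = 3\<close>, where there are triangles, is not special.
\<close>

definition hex_ends :: "'a set \<Rightarrow> 'a set set \<Rightarrow> 'a \<Rightarrow> 'a \<Rightarrow> 'a \<Rightarrow> 'a set" where
  "hex_ends V E x v y =
     {p\<in>V. {y, p} \<in> E \<and> p \<noteq> v \<and> (\<exists>q\<in>V. \<exists>r\<in>V. {p, q} \<in> E \<and> {q, r} \<in> E \<and> {r, x} \<in> E \<and>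
        q \<noteq> y \<and> r \<noteq> p \<and> q \<noteq> x \<and> r \<noteq> v)}"

lemma hex_ends_image:
  assumes f: "graph_automorphism V E f" and V: "x \<in> V" "v \<in> V" "y \<in> V"
  shows "hex_ends V E (f x) (f v) (f y) = f ` hex_ends V E x v y"
proof
  show "f ` hex_ends V E x v y \<subseteq> hex_ends V E (f x) (f v) (f y)"
  proof
    fix p' assume "p' \<in> f ` hex_ends V E x v y"
    then obtain p q r where p: "p' = f p" "p \<in> V" "{y, p} \<in> E" "p \<noteq> v" "q \<in> V" "r \<in> V"
      "{p, q} \<in> E" "{q, r} \<in> E" "{r, x} \<in> E" "q \<noteq> y" "r \<noteq> p" "q \<noteq> x" "r \<noteq> v"
      unfolding hex_ends_def by blast
    then have "{f p, f q} \<in> E \<and> {f q, f r} \<in> E \<and> {f r, f x} \<in> E \<and>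
        f q \<noteq> f y \<and> f r \<noteq> f p \<and> f q \<noteq> f x \<and> f r \<noteq> f v"
      using V by (simp add: graph_automorphism_edge[OF f] graph_automorphism_inj[OF f])
    moreover have "f p \<in> V \<and> f q \<in> V \<and> f r \<in> V \<and> {f y, f p} \<in> E \<and> f p \<noteq> f v"
      using p V
      by (simp add: graph_automorphism_edge[OF f] graph_automorphism_inj[OF f] graph_automorphism_in[OF f])
    ultimately show "p' \<in> hex_ends V E (f x) (f v) (f y)"
      unfolding hex_ends_def p(1) by blast
  qed
  show "hex_ends V E (f x) (f v) (f y) \<subseteq> f ` hex_ends V E x v y"
  proof
    fix p' assume "p' \<in> hex_ends V E (f x) (f v) (f y)"
    then obtain q' r' where p: "p' \<in> V" "{f y, p'} \<in> E" "p' \<noteq> f v" "q' \<in> V" "r' \<in> V"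
      "{p', q'} \<in> E" "{q', r'} \<in> E" "{r', f x} \<in> E" "q' \<noteq> f y" "r' \<noteq> p'" "q' \<noteq> f x" "r' \<noteq> f v"
      unfolding hex_ends_def by blast
    obtain p q r where "p' = f p" "q' = f q" "r' = f r" "p \<in> V" "q \<in> V" "r \<in> V"
      using graph_automorphism_surj[OF f] p(1,4,5) by metis
    then have "p \<in> hex_ends V E x v y"
      unfolding hex_ends_def using p V
      by (auto simp: graph_automorphism_edge[OF f] graph_automorphism_inj[OF f])
    then show "p' \<in> f ` hex_ends V E x v y"
      using \<open>p' = f p\<close> by blast
  qed
qed

lemma card_hex_ends_automorphism:
  assumes f: "graph_automorphism V E f" and V: "x \<in> V" "v \<in> V" "y \<in> V"
  shows "card (hex_ends V E (f x) (f v) (f y)) = card (hex_ends V E x v y)"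
proof -
  have "inj_on f (hex_ends V E x v y)"
    using f unfolding inj_on_def hex_ends_def by (auto simp: graph_automorphism_inj)
  then show ?thesis
    unfolding hex_ends_image[OF assms] by (rule card_image)
qed

section \<open>Bouwer graphs in lifted coordinates\<close>

datatype step = Up nat | Dn nat

fun label :: "step \<Rightarrow> nat" where
  "label (Up l) = l"
| "label (Dn l) = l"

fun opp :: "step \<Rightarrow> step" where
  "opp (Up l) = Dn l"
| "opp (Dn l) = Up l"

fun is_up :: "step \<Rightarrow> bool" where
  "is_up (Up l) = True"
| "is_up (Dn l) = False"

lemma opp_simps [simp]: "opp (opp s) = s" "label (opp s) = label s" "is_up (opp s) \<longleftrightarrow> \<not> is_up s"
  by (cases s; simp)+

text \<open>
  A vertex is lifted to a level \<open>A\<close> in the natural numbers and an integer vector \<open>\<beta>\<close>; the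
  coordinate \<open>\<beta> 0\<close> is immaterial, and the step that leaves the vector part of a vertex unchanged
  is treated as the step that changes \<open>\<beta> 0\<close>. This makes the \<open>k\<close> labels interchangeable: the
  coordinates with indices in \<open>{..<k}\<close> sum to \<open>2 ^ A\<close> along every walk if they do so at the start.
\<close>

fun mv :: "step \<Rightarrow> nat \<times> (nat \<Rightarrow> int) \<Rightarrow> nat \<times> (nat \<Rightarrow> int)" where
  "mv (Up l) (A, \<beta>) = (Suc A, \<lambda>i. \<beta> i + (if l = i then 2 ^ A else 0))"
| "mv (Dn l) (A, \<beta>) = (A - 1, \<lambda>i. \<beta> i - (if l = i then 2 ^ (A - 1) else 0))"

text \<open>Stepping down from level 0 is truncated and cannot be undone, whence the recurring
  hypotheses that levels are positive.\<close>

lemma mv_opp: "0 < fst X \<Longrightarrow> mv (opp s) (mv s X) = X"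
  by (cases X; cases s) auto

lemma fst_mv: "fst (mv s X) = (if is_up s then Suc (fst X) else fst X - 1)"
  by (cases X; cases s) auto

locale bouwer =
  fixes k m n :: nat
  assumes k: "k > 1" and m: "m > 1" and n: "n > 1" and pow: "[2 ^ m = 1] (mod n)"
begin

abbreviation "V \<equiv> bouwer_vertices k m n"
abbreviation "E \<equiv> bouwer_edges k m n"

fun pt :: "nat \<times> (nat \<Rightarrow> int) \<Rightarrow> nat \<times> (nat \<Rightarrow> nat)" where
  "pt (A, \<beta>) = (A mod m, \<lambda>i\<in>{1..k-1}. nat (\<beta> i mod int n))"

declare pt.simps [simp del]

lemma pow_mod_level:
  assumes "A mod m = B mod m"
  shows "[2 ^ A = 2 ^ B] (mod (int n))"
proof -
  have "[2 ^ A = 2 ^ (A mod m)] (mod n)" for A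
  proof -
    have "[(2 ^ m) ^ (A div m) * 2 ^ (A mod m) = 1 ^ (A div m) * 2 ^ (A mod m)] (mod n)"
      using pow by (intro cong_mult cong_pow cong_refl)
    moreover have "(2 ^ m) ^ (A div m) * 2 ^ (A mod m) = (2::nat) ^ A"
      by (metis mult_div_mod_eq power_add power_mult)
    ultimately show ?thesis by simp
  qed
  then have "[2 ^ A = 2 ^ B] (mod n)"
    using assms by (metis cong_sym cong_trans)
  then show ?thesis
    by (metis cong_int_iff of_nat_numeral of_nat_power)
qed

lemma n_odd: "odd n"
proof
  assume "even n"
  then have "even ((2::nat) ^ m) = even (1::nat)"
    using pow cong_dvd_iff cong_dvd_modulus_nat by blast
  then show False using m by simp
qed

lemma dvd_pow2_mult_iff: "int n dvd 2 ^ c * z \<longleftrightarrow> int n dvd z"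
proof -
  have "coprime (int n) (2 ^ c)"
    using n_odd by simp
  then show ?thesis
    by (simp add: coprime_dvd_mult_right_iff)
qed

lemma pt_eq_iff:
  "pt (A, \<beta>) = pt (B, \<gamma>) \<longleftrightarrow>
     A mod m = B mod m \<and> (\<forall>i\<in>{1..k-1}. [\<beta> i = \<gamma> i] (mod int n))"
proof -
  have "(\<lambda>i\<in>{1..k-1}. nat (\<beta> i mod int n)) = (\<lambda>i\<in>{1..k-1}. nat (\<gamma> i mod int n)) \<longleftrightarrow>
    (\<forall>i\<in>{1..k-1}. nat (\<beta> i mod int n) = nat (\<gamma> i mod int n))"
    by (auto simp: fun_eq_iff restrict_def split: if_splits)
  moreover have "nat (\<beta> i mod int n) = nat (\<gamma> i mod int n) \<longleftrightarrow> [\<beta> i = \<gamma> i] (mod int n)" for i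
    using n by (simp add: cong_def eq_nat_nat_iff)
  ultimately show ?thesis by (simp add: pt.simps)
qed

lemma pt_cong:
  "A mod m = B mod m \<Longrightarrow> (\<And>i. i \<in> {1..k-1} \<Longrightarrow> [\<beta> i = \<gamma> i] (mod int n)) \<Longrightarrow> pt (A, \<beta>) = pt (B, \<gamma>)"
  using pt_eq_iff by blast

lemma pt_in [simp]: "pt X \<in> V"
proof (cases X)
  case (Pair A \<beta>)
  have "nat (\<beta> i mod int n) < n" for i
    using n by (simp add: nat_less_iff)
  then show ?thesis
    using m unfolding Pair bouwer_vertices_def pt.simps by auto
qed

text \<open>Adding multiples of \<open>m\<close> lifts the level above any bound \<open>c\<close>,
  so that later walks have room to descend; the free coordinate 0 is spent on making the total equal
  to \<open>2 ^ A\<close>.\<close>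

lemma vertex_lift:
  assumes "v \<in> V"
  obtains A \<beta> where "v = pt (A, \<beta>)" "c \<le> A" "(\<Sum>i<k. \<beta> i) = 2 ^ A"
proof -
  obtain a b where v: "v = (a, b)" "a < m" "b \<in> {1..k-1} \<rightarrow>\<^sub>E {0..<n}"
    using assms unfolding bouwer_vertices_def by auto
  define A where "A = a + m * c"
  define \<beta> where "\<beta> i = (if i = 0 then 2 ^ A - (\<Sum>i\<in>{1..k-1}. int (b i)) else int (b i))" for i
  have "b = (\<lambda>i\<in>{1..k-1}. nat (\<beta> i mod int n))"
  proof
    fix i
    show "b i = (\<lambda>i\<in>{1..k-1}. nat (\<beta> i mod int n)) i"
    proof (cases "i \<in> {1..k-1}")
      case True
      then have "b i < n" using v(3) by auto
      then show ?thesis using True unfolding \<beta>_def by (simp add: nat_int)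
    next
      case False
      then show ?thesis using v(3) by (auto simp: PiE_def extensional_def)
    qed
  qed
  then have "v = pt (A, \<beta>)"
    using v unfolding A_def by (simp add: pt.simps)
  moreover have "c \<le> A"
    using m unfolding A_def by (simp add: trans_le_add2)
  moreover have "(\<Sum>i<k. \<beta> i) = 2 ^ A"
  proof -
    have "{..<k} = insert 0 {1..k-1}" using k by auto
    then have "(\<Sum>i<k. \<beta> i) = \<beta> 0 + (\<Sum>i\<in>{1..k-1}. \<beta> i)" by simp
    also have "(\<Sum>i\<in>{1..k-1}. \<beta> i) = (\<Sum>i\<in>{1..k-1}. int (b i))"
      by (rule sum.cong) (auto simp: \<beta>_def)
    finally show ?thesis by (simp add: \<beta>_def)
  qed
  ultimately show ?thesis using that by blast
qed

lemma pt_mv_up: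
  assumes "l < k" and v: "pt (A, \<beta>) = (a, b)"
  shows "pt (mv (Up l) (A, \<beta>)) = ((a + 1) mod m,
    if l = 0 then b else (\<lambda>i\<in>{1..k-1}. (b i + 2 ^ a * unit_vector l i) mod n))"
proof -
  have a: "a = A mod m" and b: "b = (\<lambda>i\<in>{1..k-1}. nat (\<beta> i mod int n))"
    using v by (auto simp: pt.simps)
  have "Suc A mod m = (a + 1) mod m" by (simp add: a mod_Suc_eq)
  moreover have "(\<lambda>i\<in>{1..k-1}. nat ((\<beta> i + (if l = i then 2 ^ A else 0)) mod int n)) =
    (if l = 0 then b else (\<lambda>i\<in>{1..k-1}. (b i + 2 ^ a * unit_vector l i) mod n))"
  proof (cases "l = 0")
    case True
    then show ?thesis unfolding b by (auto simp: restrict_def)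
  next
    case False
    have "nat ((\<beta> i + (if l = i then 2 ^ A else 0)) mod int n) = (b i + 2 ^ a * unit_vector l i) mod n"
      if i: "i \<in> {1..k-1}" for i
    proof -
      have "int (b i) = \<beta> i mod int n" using i n unfolding b by simp
      then have bi: "[int (b i) = \<beta> i] (mod int n)"
        by (simp add: cong_def)
      have "[2 ^ a = 2 ^ A] (mod int n)"
        using pow_mod_level by (simp add: a)
      then have "[int (b i) + (if l = i then 2 ^ a else 0) = \<beta> i + (if l = i then 2 ^ A else 0)] (mod int n)"
        using bi by (auto intro: cong_add)
      moreover have "int (b i) + (if l = i then 2 ^ a else 0) = int (b i + 2 ^ a * unit_vector l i)"
        by (auto simp: unit_vector_def)
      ultimately have "(\<beta> i + (if l = i then 2 ^ A else 0)) mod int n = int ((b i + 2 ^ a * unit_vector l i) mod n)"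
        by (metis cong_def zmod_int)
      then show ?thesis by simp
    qed
    then show ?thesis using False by (auto simp: restrict_def)
  qed
  ultimately show ?thesis by (simp add: pt.simps)
qed

lemma edge_up: "l < k \<Longrightarrow> {pt X, pt (mv (Up l) X)} \<in> E"
proof -
  assume l: "l < k"
  obtain A \<beta> where X: "X = (A, \<beta>)" by (cases X)
  obtain a b where v: "pt (A, \<beta>) = (a, b)" by (cases "pt (A, \<beta>)")
  have "(a, b) \<in> V" using pt_in[of "(A, \<beta>)"] v by simp
  moreover have "l = 0 \<or> l \<in> {1..k-1}" using l by auto
  ultimately have "{(a, b), ((a + 1) mod m,
    if l = 0 then b else (\<lambda>i\<in>{1..k-1}. (b i + 2 ^ a * unit_vector l i) mod n))} \<in> E"
    unfolding bouwer_edges_def mem_Collect_eq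
    by (intro exI[of _ a] exI[of _ b] exI conjI refl) auto
  then show ?thesis
    unfolding X pt_mv_up[OF l v] v .
qed

lemma edge_lift:
  assumes "e \<in> E"
  obtains A \<beta> l where "e = {pt (A, \<beta>), pt (mv (Up l) (A, \<beta>))}" "l < k" "c \<le> A" "(\<Sum>i<k. \<beta> i) = 2 ^ A"
proof -
  obtain a b d where e: "e = {(a, b), ((a + 1) mod m, d)}" "(a, b) \<in> V"
    "d = b \<or> (\<exists>j\<in>{1..k-1}. d = (\<lambda>i\<in>{1..k-1}. (b i + 2 ^ a * unit_vector j i) mod n))"
    using assms unfolding bouwer_edges_def by blast
  obtain l where l: "l < k" "d = (if l = 0 then b else (\<lambda>i\<in>{1..k-1}. (b i + 2 ^ a * unit_vector l i) mod n))"
  proof (cases "d = b")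
    case True
    then show ?thesis using that[of 0] k by simp
  next
    case False
    then obtain j where j: "j \<in> {1..k-1}" "d = (\<lambda>i\<in>{1..k-1}. (b i + 2 ^ a * unit_vector j i) mod n)"
      using e(3) by blast
    then show ?thesis using that[of j] by auto
  qed
  obtain A \<beta> where v: "(a, b) = pt (A, \<beta>)" "c \<le> A" "(\<Sum>i<k. \<beta> i) = 2 ^ A"
    by (rule vertex_lift[OF e(2)])
  show ?thesis
    using that[of A \<beta> l] pt_mv_up[OF l(1) v(1)[symmetric]] v e(1) l by simp
qed

lemma finite_V: "finite V"
  unfolding bouwer_vertices_def by (intro finite_cartesian_product finite_PiE) auto

lemma E_sub: "E \<subseteq> Pow V"
proof
  fix e assume "e \<in> E"
  then obtain A \<beta> l where "e = {pt (A, \<beta>), pt (mv (Up l) (A, \<beta>))}"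
    by (rule edge_lift)
  then show "e \<in> Pow V" by simp
qed

text \<open>Makes a step well defined on vertices: two lifts of one vertex agree in level modulo
  \<open>m\<close>, and that determines the added power of two modulo \<open>n\<close>.\<close>

lemma pt_mv_cong:
  assumes "pt X = pt Y" "0 < fst X" "0 < fst Y"
  shows "pt (mv s X) = pt (mv s Y)"
proof -
  obtain A \<beta> B \<gamma> where X: "X = (A, \<beta>)" "Y = (B, \<gamma>)"
    by (metis surj_pair)
  have lv: "A mod m = B mod m" and c: "\<And>i. i \<in> {1..k-1} \<Longrightarrow> [\<beta> i = \<gamma> i] (mod int n)"
    using assms(1) unfolding X pt_eq_iff by auto
  have "[(A - 1) + 1 = (B - 1) + 1] (mod m)"
    using assms(2,3) lv unfolding X cong_def by simp
  then have lv1: "(A - 1) mod m = (B - 1) mod m"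
    by (simp only: cong_add_rcancel_nat) (simp add: cong_def)
  show ?thesis
  proof (cases s)
    case (Up l)
    have "Suc A mod m = Suc B mod m" using lv by (metis mod_Suc_eq)
    then show ?thesis unfolding Up X mv.simps
      using c pow_mod_level[OF lv] by (intro pt_cong) (auto intro: cong_add)
  next
    case (Dn l)
    show ?thesis unfolding Dn X mv.simps
      using c lv1 pow_mod_level[OF lv1] by (intro pt_cong) (auto intro: cong_diff)
  qed
qed

lemma edge_dn:
  assumes "l < k" "0 < fst X"
  shows "{pt X, pt (mv (Dn l) X)} \<in> E"
proof -
  have "mv (Up l) (mv (Dn l) X) = X"
    using mv_opp[OF assms(2), of "Dn l"] by simp
  then show ?thesis
    using edge_up[OF assms(1), of "mv (Dn l) X"] by (metis insert_commute)
qed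

lemma edge_mv: "label s < k \<Longrightarrow> 0 < fst X \<Longrightarrow> {pt X, pt (mv s X)} \<in> E"
  by (cases s) (simp_all add: edge_up edge_dn)

lemma neighbour_lift:
  assumes "{pt X, w} \<in> E" and X: "0 < fst X"
  obtains s where "label s < k" "w = pt (mv s X)"
proof -
  obtain A \<beta> l where e: "{pt X, w} = {pt (A, \<beta>), pt (mv (Up l) (A, \<beta>))}" "l < k" "1 \<le> A"
    by (rule edge_lift[OF assms(1), of 1])
  then consider "pt X = pt (A, \<beta>)" "w = pt (mv (Up l) (A, \<beta>))"
    | "pt X = pt (mv (Up l) (A, \<beta>))" "w = pt (A, \<beta>)"
    by (auto simp: doubleton_eq_iff)
  then show ?thesis
  proof cases
    case 1
    then have "w = pt (mv (Up l) X)"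
      using pt_mv_cong[of X "(A, \<beta>)"] e X by simp
    then show ?thesis using that[of "Up l"] e by simp
  next
    case 2
    then have "pt (mv (Dn l) X) = pt (mv (Dn l) (mv (Up l) (A, \<beta>)))"
      using pt_mv_cong X by auto
    also have "\<dots> = w" using 2 mv_opp[of "(A, \<beta>)" "Up l"] e by simp
    finally show ?thesis using that[of "Dn l"] e by simp
  qed
qed

section \<open>Vertex- and edge-transitivity\<close>

text \<open>On lifts this is the affine map that raises the level by \<open>c\<close> and sends the
  vector beta to 2^c (beta o pi) + gamma. As a map on vertices it has to recover the forgotten
  coordinate 0, which the \<open>if\<close> does from the total.\<close>

definition rot :: "nat \<Rightarrow> (nat \<Rightarrow> nat) \<Rightarrow> (nat \<Rightarrow> int) \<Rightarrow> nat \<times> (nat \<Rightarrow> nat) \<Rightarrow> nat \<times> (nat \<Rightarrow> nat)" where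
  "rot c \<pi> \<gamma> v = pt (fst v + c, \<lambda>i. 2 ^ c *
     (if \<pi> i = 0 then 2 ^ fst v - (\<Sum>j\<in>{1..k-1}. int (snd v j)) else int (snd v (\<pi> i))) + \<gamma> i)"

lemma rot_pt:
  assumes \<pi>: "\<forall>i<k. \<pi> i < k" and s: "(\<Sum>i<k. \<beta> i) = 2 ^ A"
  shows "rot c \<pi> \<gamma> (pt (A, \<beta>)) = pt (A + c, \<lambda>i. 2 ^ c * \<beta> (\<pi> i) + \<gamma> i)"
  unfolding rot_def
proof (rule pt_cong)
  show "(fst (pt (A, \<beta>)) + c) mod m = (A + c) mod m" by (simp add: pt.simps mod_simps)
  fix i assume i: "i \<in> {1..k-1}"
  let ?b = "snd (pt (A, \<beta>))"
  have b: "[int (?b j) = \<beta> j] (mod int n)" if "j \<in> {1..k-1}" for j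
    using that n by (simp add: cong_def pt.simps)
  have "{..<k} = insert 0 {1..k-1}" using k by auto
  then have "(\<Sum>i<k. \<beta> i) = \<beta> 0 + (\<Sum>i\<in>{1..k-1}. \<beta> i)" by simp
  then have b0: "\<beta> 0 = 2 ^ A - (\<Sum>i\<in>{1..k-1}. \<beta> i)" using s by simp
  have "[2 ^ fst (pt (A, \<beta>)) = 2 ^ A] (mod int n)"
    by (intro pow_mod_level) (simp add: pt.simps)
  then have "[2 ^ fst (pt (A, \<beta>)) - (\<Sum>j\<in>{1..k-1}. int (?b j)) = \<beta> 0] (mod int n)"
    unfolding b0 by (intro cong_diff cong_sum b)
  moreover have "\<pi> i = 0 \<or> \<pi> i \<in> {1..k-1}"
  proof -
    have "i < k" using i k by auto
    then have "\<pi> i < k" using \<pi> by blast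
    then show ?thesis by auto
  qed
  ultimately have "[(if \<pi> i = 0 then 2 ^ fst (pt (A, \<beta>)) - (\<Sum>j\<in>{1..k-1}. int (?b j)) else int (?b (\<pi> i)))
    = \<beta> (\<pi> i)] (mod int n)"
    using b by auto
  then show "[2 ^ c * (if \<pi> i = 0 then 2 ^ fst (pt (A, \<beta>)) - (\<Sum>j\<in>{1..k-1}. int (?b j)) else int (?b (\<pi> i))) + \<gamma> i
    = 2 ^ c * \<beta> (\<pi> i) + \<gamma> i] (mod int n)"
    by (intro cong_add cong_mult cong_refl)
qed

lemma rot_automorphism:
  assumes \<pi>: "bij_betw \<pi> {..<k} {..<k}"
  shows "graph_automorphism V E (rot c \<pi> \<gamma>)"
proof (rule graph_automorphismI[OF finite_V E_sub])
  have \<pi>': "\<forall>i<k. \<pi> i < k"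
    using bij_betw_apply[OF \<pi>] by auto
  have onto: "\<exists>j<k. i = \<pi> j" if "i < k" for i
  proof -
    have "i \<in> \<pi> ` {..<k}" using \<pi> that unfolding bij_betw_def by simp
    then show ?thesis by blast
  qed
  show "rot c \<pi> \<gamma> ` V \<subseteq> V" unfolding rot_def by (simp add: image_subset_iff)
  show "inj_on (rot c \<pi> \<gamma>) V"
  proof (rule inj_onI)
    fix u v assume u: "u \<in> V" and v: "v \<in> V" and eq: "rot c \<pi> \<gamma> u = rot c \<pi> \<gamma> v"
    obtain A \<beta> where A: "u = pt (A, \<beta>)" "(\<Sum>i<k. \<beta> i) = 2 ^ A" by (rule vertex_lift[OF u])
    obtain B \<delta> where B: "v = pt (B, \<delta>)" "(\<Sum>i<k. \<delta> i) = 2 ^ B" by (rule vertex_lift[OF v])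
    have e: "(A + c) mod m = (B + c) mod m"
      "\<And>i. i \<in> {1..k-1} \<Longrightarrow> [2 ^ c * \<beta> (\<pi> i) + \<gamma> i = 2 ^ c * \<delta> (\<pi> i) + \<gamma> i] (mod int n)"
      using eq unfolding A(1) B(1) rot_pt[OF \<pi>' A(2)] rot_pt[OF \<pi>' B(2)] pt_eq_iff by auto
    have AB: "A mod m = B mod m"
      using e(1) cong_add_rcancel_nat unfolding cong_def by blast
    have c1: "[\<beta> (\<pi> i) = \<delta> (\<pi> i)] (mod int n)" if i: "i \<in> {1..k-1}" for i
    proof -
      have "int n dvd 2 ^ c * (\<beta> (\<pi> i) - \<delta> (\<pi> i))"
        using e(2)[OF i] by (simp add: cong_iff_dvd_diff algebra_simps)
      then show ?thesis by (simp add: dvd_pow2_mult_iff cong_iff_dvd_diff)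
    qed
    \<comment> \<open>The images show only the coordinates \<open>\<pi> i\<close> with
      \<open>i\<close> at least 1; the missing one is determined by the total.\<close>
    have c0: "[\<beta> (\<pi> 0) = \<delta> (\<pi> 0)] (mod int n)"
    proof -
      have s: "(\<Sum>i<k. f i) = f (\<pi> 0) + (\<Sum>i\<in>{1..k-1}. f (\<pi> i))" for f :: "nat \<Rightarrow> int"
      proof -
        have "(\<Sum>i<k. f i) = (\<Sum>i<k. f (\<pi> i))"
          using sum.reindex_bij_betw[OF \<pi>] by metis
        also have "\<dots> = (\<Sum>i\<in>insert 0 {1..k-1}. f (\<pi> i))"
          using k by (intro sum.cong) auto
        finally show ?thesis by simp
      qed
      have "[2 ^ A - (\<Sum>i\<in>{1..k-1}. \<beta> (\<pi> i)) = 2 ^ B - (\<Sum>i\<in>{1..k-1}. \<delta> (\<pi> i))] (mod int n)"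
        by (intro cong_diff cong_sum pow_mod_level AB c1)
      moreover have "\<beta> (\<pi> 0) = 2 ^ A - (\<Sum>i\<in>{1..k-1}. \<beta> (\<pi> i))"
        "\<delta> (\<pi> 0) = 2 ^ B - (\<Sum>i\<in>{1..k-1}. \<delta> (\<pi> i))"
        using A(2) B(2) s[of \<beta>] s[of \<delta>] by simp_all
      ultimately show ?thesis by simp
    qed
    have "[\<beta> i = \<delta> i] (mod int n)" if "i \<in> {1..k-1}" for i
    proof -
      have "i < k" using \<open>i \<in> {1..k-1}\<close> k by auto
      then obtain j where j: "j < k" "i = \<pi> j"
        using onto by blast
      then show ?thesis using c0 c1[of j] by (cases "j = 0") auto
    qed
    then show "u = v" unfolding A B using AB by (intro pt_cong)
  qed
  fix e assume "e \<in> E"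
  then obtain A \<beta> l where e: "e = {pt (A, \<beta>), pt (mv (Up l) (A, \<beta>))}" "l < k" "1 \<le> A" "(\<Sum>i<k. \<beta> i) = 2 ^ A"
    by (rule edge_lift)
  obtain j where j: "j < k" "l = \<pi> j"
    using onto e(2) by blast
  let ?X = "(A + c, \<lambda>i. 2 ^ c * \<beta> (\<pi> i) + \<gamma> i)"
  have s: "(\<Sum>i<k. \<beta> i + (if l = i then 2 ^ A else 0)) = 2 ^ Suc A"
    using e by (simp add: sum.distrib)
  have "rot c \<pi> \<gamma> (pt (mv (Up l) (A, \<beta>))) = pt (mv (Up j) ?X)"
    unfolding mv.simps rot_pt[OF \<pi>' s]
  proof (rule pt_cong)
    fix i assume "i \<in> {1..k-1}"
    then have "\<pi> j = \<pi> i \<longleftrightarrow> j = i"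
      using \<pi> j(1) unfolding bij_betw_def by (intro inj_on_eq_iff[of _ "{..<k}"]) auto
    then show "[2 ^ c * (\<beta> (\<pi> i) + (if l = \<pi> i then 2 ^ A else 0)) + \<gamma> i =
         2 ^ c * \<beta> (\<pi> i) + \<gamma> i + (if j = i then 2 ^ (A + c) else 0)] (mod int n)"
      unfolding j(2) by (simp add: algebra_simps power_add)
  qed simp
  then show "rot c \<pi> \<gamma> ` e \<in> E"
    using edge_up[OF j(1), of ?X] unfolding e(1) by (simp add: rot_pt[OF \<pi>' e(4)])
qed

text \<open>Raising by \<open>C - A\<close> levels rescales the vector, a transposition exchanges
  the labels \<open>l\<close> and \<open>j\<close>, and a translation corrects the rest. The target
  is lifted above \<open>A\<close> so that \<open>C - A\<close> is a genuine difference.\<close>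

lemma forward_arc_transitive:
  assumes A: "(\<Sum>i<k. \<beta> i) = 2 ^ A" and B: "v \<in> V" and l: "l < k" "j < k"
  shows "\<exists>f C \<delta>. graph_automorphism V E f \<and> f (pt (A, \<beta>)) = v \<and> v = pt (C, \<delta>) \<and>
    0 < C \<and> f (pt (mv (Up l) (A, \<beta>))) = pt (mv (Up j) (C, \<delta>))"
proof -
  obtain C \<delta> where C: "v = pt (C, \<delta>)" "Suc A \<le> C" "(\<Sum>i<k. \<delta> i) = 2 ^ C"
    by (rule vertex_lift[OF B])
  define c where "c = C - A"
  define \<pi> where "\<pi> = id(l := j, j := l)"
  define \<gamma> where "\<gamma> i = \<delta> i - 2 ^ c * \<beta> (\<pi> i)" for i
  have c: "A + c = C" using C unfolding c_def by simp
  have \<pi>: "\<forall>i<k. \<pi> i < k"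
    using l unfolding \<pi>_def by auto
  have bij: "bij_betw \<pi> {..<k} {..<k}"
    by (rule bij_betwI[where g = \<pi>]) (use \<pi> in auto, auto simp: \<pi>_def)
  have s: "(\<Sum>i<k. \<beta> i + (if l = i then 2 ^ A else 0)) = 2 ^ Suc A"
    using A l by (simp add: sum.distrib)
  have 1: "rot c \<pi> \<gamma> (pt (A, \<beta>)) = pt (C, \<delta>)"
    unfolding rot_pt[OF \<pi> A] c by (simp add: \<gamma>_def)
  have 2: "rot c \<pi> \<gamma> (pt (mv (Up l) (A, \<beta>))) = pt (mv (Up j) (C, \<delta>))"
  proof -
    have "(l = \<pi> i) = (j = i)" for i unfolding \<pi>_def by auto
    then show ?thesis
      unfolding mv.simps rot_pt[OF \<pi> s] \<gamma>_def using c
      by (intro pt_cong) (auto simp: algebra_simps power_add[symmetric])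
  qed
  have "0 < C" using C by simp
  with C(1) 1 2 show ?thesis using rot_automorphism[OF bij, of c \<gamma>]
    by (intro exI[of _ "rot c \<pi> \<gamma>"] exI[of _ C] exI[of _ \<delta>]) simp
qed

lemma vertex_transitive_bouwer: "vertex_transitive V E"
  unfolding vertex_transitive_def
proof (intro ballI)
  fix u v assume "u \<in> V" "v \<in> V"
  obtain A \<beta> where "u = pt (A, \<beta>)" "(\<Sum>i<k. \<beta> i) = 2 ^ A"
    by (rule vertex_lift[OF \<open>u \<in> V\<close>])
  then show "\<exists>f. graph_automorphism V E f \<and> f u = v"
    using forward_arc_transitive[of \<beta> A v 0 0] \<open>v \<in> V\<close> k by auto
qed

lemma edge_lift_target:
  assumes "(\<Sum>i<k. \<beta> i) = 2 ^ A" "l < k" "j < k" "0 < B"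
  shows "\<exists>f. graph_automorphism V E f \<and> f (pt (A, \<beta>)) = pt (B, \<gamma>) \<and>
    f (pt (mv (Up l) (A, \<beta>))) = pt (mv (Up j) (B, \<gamma>))"
proof -
  obtain f C \<delta> where f: "graph_automorphism V E f" "f (pt (A, \<beta>)) = pt (B, \<gamma>)"
    "pt (B, \<gamma>) = pt (C, \<delta>)" "0 < C" "f (pt (mv (Up l) (A, \<beta>))) = pt (mv (Up j) (C, \<delta>))"
    using forward_arc_transitive[OF assms(1) pt_in[of "(B, \<gamma>)"] assms(2,3)] by metis
  then show ?thesis
    using pt_mv_cong[of "(B, \<gamma>)" "(C, \<delta>)" "Up j"] assms(4) by auto
qed

lemma edge_transitive_bouwer: "edge_transitive V E"
  unfolding edge_transitive_def
proof (intro ballI)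
  fix e e' assume "e \<in> E" "e' \<in> E"
  obtain A \<beta> l where e: "e = {pt (A, \<beta>), pt (mv (Up l) (A, \<beta>))}" "l < k" "1 \<le> A" "(\<Sum>i<k. \<beta> i) = 2 ^ A"
    by (rule edge_lift[OF \<open>e \<in> E\<close>, of 1])
  obtain B \<gamma> j where e': "e' = {pt (B, \<gamma>), pt (mv (Up j) (B, \<gamma>))}" "j < k" "1 \<le> B" "(\<Sum>i<k. \<gamma> i) = 2 ^ B"
    by (rule edge_lift[OF \<open>e' \<in> E\<close>, of 1])
  show "\<exists>f. graph_automorphism V E f \<and> f ` e = e'"
    using edge_lift_target[OF e(4) e(2) e'(2), of B \<gamma>] e' unfolding e(1) e'(1) by auto
qed

text \<open>The reversed arc may lie over a different edge, because forward arcs can be moved to one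
  another before and after applying \<open>f\<close>.\<close>

lemma arc_transitiveI:
  assumes f: "graph_automorphism V E f" and X: "0 < fst X" "l < k" and Y: "0 < fst Y" "j < k"
    and rev: "f (pt X) = pt (mv (Up j) Y)" "f (pt (mv (Up l) X)) = pt Y"
  shows "arc_transitive V E"
proof -
  define up where "up u v \<longleftrightarrow> (\<exists>X l. u = pt X \<and> v = pt (mv (Up l) X) \<and> l < k \<and> 0 < fst X)" for u v
  define tr where "tr u v x y \<longleftrightarrow> (\<exists>g. graph_automorphism V E g \<and> g u = x \<and> g v = y)" for u v x y
  have arc: "up u v \<or> up v u" if uv: "{u, v} \<in> E" for u v
  proof -
    obtain A \<beta> l where "{u, v} = {pt (A, \<beta>), pt (mv (Up l) (A, \<beta>))}" "l < k" "1 \<le> A" "(\<Sum>i<k. \<beta> i) = 2 ^ A"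
      by (rule edge_lift[OF uv, of 1])
    then have "0 < fst (A, \<beta>)" "u = pt (A, \<beta>) \<and> v = pt (mv (Up l) (A, \<beta>)) \<or> v = pt (A, \<beta>) \<and> u = pt (mv (Up l) (A, \<beta>))"
      by (auto simp: doubleton_eq_iff)
    then show ?thesis unfolding up_def using \<open>l < k\<close> by blast
  qed
  have upup: "tr u v x y" if uv: "up u v" and xy: "up x y" for u v x y
  proof -
    obtain X l where 1: "u = pt X" "v = pt (mv (Up l) X)" "l < k" "0 < fst X"
      using uv unfolding up_def by blast
    obtain A \<beta> where A: "pt X = pt (A, \<beta>)" "1 \<le> A" "(\<Sum>i<k. \<beta> i) = 2 ^ A"
      by (rule vertex_lift[OF pt_in])
    have v: "v = pt (mv (Up l) (A, \<beta>))"
      unfolding 1(2) using A 1(4) by (intro pt_mv_cong) auto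
    obtain Y j where Y: "x = pt Y" "y = pt (mv (Up j) Y)" "j < k" "0 < fst Y"
      using xy unfolding up_def by blast
    then show ?thesis
      unfolding tr_def 1(1) v A(1) using edge_lift_target[OF A(3) 1(3) Y(3), of "fst Y" "snd Y"] by auto
  qed
  have swap: "tr u v x y \<Longrightarrow> tr v u y x" for u v x y
    unfolding tr_def by blast
  have trans: "tr u v x y \<Longrightarrow> tr x y z w \<Longrightarrow> tr u v z w" for u v x y z w
    unfolding tr_def by (metis comp_apply graph_automorphism_comp)
  define a a' b b' where "a = pt X" "a' = pt (mv (Up l) X)" "b = pt Y" "b' = pt (mv (Up j) Y)"
  have up: "up a a'" "up b b'"
    unfolding up_def a_a'_b_b'_def using X Y by blast+
  have revtr: "tr a a' b' b"
    unfolding tr_def a_a'_b_b'_def using f rev by blast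
  have updn: "tr u v y x" if "up u v" "up x y" for u v x y
    by (rule trans[OF upup[OF that(1) up(1)]], rule trans[OF revtr], rule swap, rule upup[OF up(2) that(2)])
  have "tr u v x y" if "{u, v} \<in> E" "{x, y} \<in> E" for u v x y
    using arc[OF that(1)] arc[OF that(2)] upup updn swap by blast
  then show ?thesis
    unfolding arc_transitive_def arcs_def tr_def by auto
qed

end

section \<open>Closed walks\<close>

fun lvl :: "nat \<Rightarrow> step list \<Rightarrow> nat" where
  "lvl A [] = A"
| "lvl A (Up l # ws) = lvl (Suc A) ws"
| "lvl A (Dn l # ws) = lvl (A - 1) ws"

text \<open>Separating the change of the vector from its start turns the closing of a walk into
  divisibility of signed sums of powers of two, one sum for each label.\<close>

fun disp :: "nat \<Rightarrow> step list \<Rightarrow> nat \<Rightarrow> int" where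
  "disp A [] i = 0"
| "disp A (Up l # ws) i = (if l = i then 2 ^ A else 0) + disp (Suc A) ws i"
| "disp A (Dn l # ws) i = disp (A - 1) ws i - (if l = i then 2 ^ (A - 1) else 0)"

fun nonneg_lvl :: "nat \<Rightarrow> step list \<Rightarrow> bool" where
  "nonneg_lvl A [] \<longleftrightarrow> True"
| "nonneg_lvl A (Up l # ws) \<longleftrightarrow> nonneg_lvl (Suc A) ws"
| "nonneg_lvl A (Dn l # ws) \<longleftrightarrow> 0 < A \<and> nonneg_lvl (A - 1) ws"

lemma fold_mv: "fold mv ws (A, \<beta>) = (lvl A ws, \<lambda>i. \<beta> i + disp A ws i)"
  by (induction A ws arbitrary: \<beta> rule: lvl.induct) (auto simp: algebra_simps)

lemma lvl_shift: "nonneg_lvl c ws \<Longrightarrow> lvl (c + d) ws = lvl c ws + d"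
  by (induction c ws rule: lvl.induct) (auto simp: Nat.add_diff_assoc2 simp flip: add_Suc)

lemma disp_shift: "nonneg_lvl c ws \<Longrightarrow> disp (c + d) ws i = 2 ^ d * disp c ws i"
proof (induction c ws rule: lvl.induct)
  case (2 A l ws)
  then show ?case by (simp add: algebra_simps power_add)
next
  case (3 A l ws)
  then obtain B where "A = Suc B" by (cases A) auto
  then show ?case using 3 by (simp add: algebra_simps power_add)
qed simp

lemma nonneg_lvl_length: "length ws \<le> A \<Longrightarrow> nonneg_lvl A ws"
  by (induction A ws rule: lvl.induct) auto

text \<open>A step between levels \<open>A\<close> and \<open>A + 1\<close> contributes plus or
  minus 2^(A+1) - 2^A, so the total telescopes.\<close>

lemma sum_disp:
  "nonneg_lvl A ws \<Longrightarrow> \<forall>s\<in>set ws. label s < k \<Longrightarrow> (\<Sum>i<k. disp A ws i) = 2 ^ lvl A ws - 2 ^ A"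
proof (induction A ws rule: lvl.induct)
  case (2 A l ws)
  then show ?case by (simp add: sum.distrib)
next
  case (3 A l ws)
  then obtain B where "A = Suc B" by (cases A) auto
  then show ?case using 3 by (simp add: sum_subtractf)
qed simp

context bouwer
begin

definition closed :: "nat \<Rightarrow> step list \<Rightarrow> bool" where
  "closed A ws \<longleftrightarrow> lvl A ws mod m = A mod m \<and> (\<forall>i<k. int n dvd disp A ws i)"

text \<open>A vertex does not record coordinate 0, but the total change is divisible by
  \<open>n\<close> once the level returns modulo \<open>m\<close>, so the condition at label 0
  follows from the others. This is what allows \<open>closed\<close> to treat all labels
  alike.\<close>

lemma pt_fold_mv_iff:
  assumes ok: "nonneg_lvl A ws" and lab: "\<forall>s\<in>set ws. label s < k"
  shows "pt (fold mv ws (A, \<beta>)) = pt (A, \<beta>) \<longleftrightarrow> closed A ws"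
proof -
  have split: "{..<k} = insert 0 {1..k-1}" using k by auto
  have "int n dvd disp A ws 0" if lv: "lvl A ws mod m = A mod m" and c: "\<forall>i\<in>{1..k-1}. int n dvd disp A ws i"
  proof -
    have "int n dvd (\<Sum>i\<in>{1..k-1}. disp A ws i)"
      using c by (intro dvd_sum) auto
    moreover have "int n dvd 2 ^ lvl A ws - 2 ^ A"
      using pow_mod_level[OF lv] by (simp add: cong_iff_dvd_diff)
    moreover have "disp A ws 0 = (2 ^ lvl A ws - 2 ^ A) - (\<Sum>i\<in>{1..k-1}. disp A ws i)"
      using sum_disp[OF ok lab] unfolding split by simp
    ultimately show ?thesis by simp
  qed
  then have "closed A ws \<longleftrightarrow> lvl A ws mod m = A mod m \<and> (\<forall>i\<in>{1..k-1}. int n dvd disp A ws i)"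
    using k unfolding closed_def lessThan_iff[symmetric] split by auto
  then show ?thesis
    unfolding fold_mv pt_eq_iff by (simp add: cong_iff_dvd_diff)
qed

text \<open>Starting higher multiplies every coefficient by a power of two, which is a unit modulo
  \<open>n\<close>. Hence a walk can be examined at its lowest possible level, where the
  coefficients are smallest.\<close>

lemma closed_shift: "nonneg_lvl c ws \<Longrightarrow> closed (c + d) ws \<longleftrightarrow> closed c ws"
  using cong_add_rcancel_nat[of "lvl c ws" d c m]
  unfolding closed_def by (simp add: lvl_shift disp_shift dvd_pow2_mult_iff cong_def)

text \<open>Both differences are stated because subtraction is truncated: one of them is 0, the
  other is the net change.\<close>

lemma closed_lvl:
  assumes "closed A ws"
  shows "m dvd lvl A ws - A" "m dvd A - lvl A ws"
  using assms unfolding closed_def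
  by (metis dvd_0_right mod_eq_dvd_iff_nat nat_le_linear diff_is_0_eq)+

end

text \<open>For \<open>m \<le> 2\<close> the out-neighbours of a vertex need not be distinct from its in-neighbours.\<close>

locale bouwer3 = bouwer +
  assumes m3: "m > 2"
begin

lemma pt_mv_inj:
  assumes "pt (mv s X) = pt (mv t X)" "0 < fst X" "label s < k" "label t < k"
  shows "s = t"
proof -
  obtain A \<beta> where X: "X = (A, \<beta>)" by (metis surj_pair)
  have no: "\<not> int n dvd 2 ^ a" for a
    using dvd_pow2_mult_iff[of a 1] n by simp
  have sep: "l = j" if lj: "l < k" "j < k"
    and c: "\<forall>i\<in>{1..k-1}. int n dvd (if l = i then 2 ^ a else 0) - (if j = i then 2 ^ a else 0)" for l j a
  proof (rule ccontr)
    assume "l \<noteq> j"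
    \<comment> \<open>Distinct labels are not both 0, so one of them is a recorded
      coordinate.\<close>
    then consider "l \<in> {1..k-1}" | "j \<in> {1..k-1}" using lj by fastforce
    then show False
    proof cases
      case 1
      then show False using c[rule_format, OF 1] \<open>l \<noteq> j\<close> no by auto
    next
      case 2
      then show False using c[rule_format, OF 2] \<open>l \<noteq> j\<close> no by auto
    qed
  qed
  \<comment> \<open>The two levels differ by exactly 2, which is not 0 modulo
    \<open>m\<close>.\<close>
  have updn: False if "pt (mv (Up l) X) = pt (mv (Dn j) X)" for l j
  proof -
    have "Suc A mod m = (A - 1) mod m"
      using that unfolding X mv.simps pt_eq_iff by (rule conjunct1)
    then have "m dvd Suc A - (A - 1)"
      using mod_eq_dvd_iff_nat[of "A - 1" "Suc A" m] by simp
    moreover have "Suc A - (A - 1) = 2" using assms(2) X by simp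
    ultimately have "m dvd 2" by simp
    then have "m \<le> 2" by (rule dvd_imp_le) simp
    then show False using m3 by simp
  qed
  show ?thesis
  proof (cases s; cases t)
    fix l j assume st: "s = Up l" "t = Up j"
    have "\<forall>i\<in>{1..k-1}. int n dvd (if l = i then 2 ^ A else 0) - (if j = i then 2 ^ A else 0)"
      using assms(1) unfolding st X mv.simps pt_eq_iff by (simp add: cong_iff_dvd_diff)
    then have "l = j" using assms(3,4) unfolding st by (intro sep) simp_all
    then show ?thesis using st by simp
  next
    fix l j assume st: "s = Dn l" "t = Dn j"
    have "\<forall>i\<in>{1..k-1}. int n dvd (if j = i then 2 ^ (A-1) else 0) - (if l = i then 2 ^ (A-1) else 0)"
      using assms(1) unfolding st X mv.simps pt_eq_iff by (simp add: cong_iff_dvd_diff)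
    then have "j = l" using assms(3,4) unfolding st by (intro sep) simp_all
    then show ?thesis using st by simp
  next
    fix l j assume "s = Up l" "t = Dn j"
    then show ?thesis using assms(1) updn by blast
  next
    fix l j assume "s = Dn l" "t = Up j"
    then show ?thesis using assms(1) updn[of j l] by simp
  qed
qed

lemma pt_mv_mv_eq_iff:
  assumes "0 < fst X" "0 < fst (mv s X)" "label s < k" "label t < k"
  shows "pt (mv t (mv s X)) = pt X \<longleftrightarrow> t = opp s"
proof
  assume "pt (mv t (mv s X)) = pt X"
  then have "pt (mv t (mv s X)) = pt (mv (opp s) (mv s X))"
    using mv_opp[OF assms(1)] by simp
  then show "t = opp s" using pt_mv_inj assms by simp
next
  assume "t = opp s"
  then show "pt (mv t (mv s X)) = pt X" using mv_opp[OF assms(1)] by simp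
qed

text \<open>From level 6 any six steps stay at nonnegative levels, and by
  \<open>closed_shift\<close> every higher starting level gives the same condition. The last
  inequality forbids backtracking at the base point.\<close>

definition hex :: "step \<Rightarrow> step \<Rightarrow> step \<Rightarrow> step \<Rightarrow> step \<Rightarrow> step \<Rightarrow> bool" where
  "hex s1 s2 s3 s4 s5 s6 \<longleftrightarrow> (\<forall>s\<in>{s1, s2, s3, s4, s5, s6}. label s < k) \<and>
     s2 \<noteq> opp s1 \<and> s3 \<noteq> opp s2 \<and> s4 \<noteq> opp s3 \<and> s5 \<noteq> opp s4 \<and> s6 \<noteq> opp s5 \<and> s1 \<noteq> opp s6 \<and>
     closed 6 [s1, s2, s3, s4, s5, s6]"

lemma hexI:
  assumes "\<forall>s\<in>{s1, s2, s3, s4, s5, s6}. label s < k"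
     "s2 \<noteq> opp s1" "s3 \<noteq> opp s2" "s4 \<noteq> opp s3" "s5 \<noteq> opp s4" "s6 \<noteq> opp s5" "s1 \<noteq> opp s6"
     "closed 6 [s1, s2, s3, s4, s5, s6]"
  shows "hex s1 s2 s3 s4 s5 s6"
  using assms unfolding hex_def by blast

definition ends :: "step \<Rightarrow> step \<Rightarrow> step set" where
  "ends s1 s2 = {s3. \<exists>s4 s5 s6. hex s1 s2 s3 s4 s5 s6}"

text \<open>Translates the invariant set of vertices into a set of third steps that depends neither
  on the vertex nor on its level. Starting from level 7 leaves a positive level after six
  steps.\<close>

lemma hex_ends_pt:
  assumes X: "7 \<le> fst X" and lab: "label s1 < k" "label s2 < k" and nb: "s2 \<noteq> opp s1"
  shows "hex_ends V E (pt X) (pt (mv s1 X)) (pt (mv s2 (mv s1 X))) =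
    (\<lambda>s3. pt (mv s3 (mv s2 (mv s1 X)))) ` ends s1 s2" (is "?L = ?f ` _")
proof -
  define X1 X2 where "X1 = mv s1 X" "X2 = mv s2 X1"
  have lv: "fst (mv s Z) \<ge> fst Z - 1" for s Z by (auto simp: fst_mv)
  have lv1: "6 \<le> fst X1" and lv2: "5 \<le> fst X2"
    using lv[of X s1] lv[of X1 s2] X unfolding X1_X2_def by auto
  have key: "hex s1 s2 s3 s4 s5 s6 \<longleftrightarrow> pt X3 \<noteq> pt X1 \<and> pt X4 \<noteq> pt X2 \<and> pt X5 \<noteq> pt X3 \<and> pt X4 \<noteq> pt X
      \<and> pt X5 \<noteq> pt X1 \<and> pt X6 = pt X"
    if l: "label s3 < k" "label s4 < k" "label s5 < k" "label s6 < k" and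
      Xs: "X3 = mv s3 X2" "X4 = mv s4 X3" "X5 = mv s5 X4" "X6 = mv s6 X5"
    for s3 s4 s5 s6 X3 X4 X5 X6
  proof -
    have lvs: "4 \<le> fst X3" "3 \<le> fst X4" "2 \<le> fst X5" "1 \<le> fst X6"
      using lv[of X2 s3] lv[of X3 s4] lv[of X4 s5] lv[of X5 s6] lv2 unfolding Xs by auto
    have "X6 = fold mv [s1, s2, s3, s4, s5, s6] (fst X, snd X)"
      unfolding Xs X1_X2_def by simp
    moreover have "nonneg_lvl (fst X) [s1, s2, s3, s4, s5, s6]"
      using X by (intro nonneg_lvl_length) simp
    moreover have "\<forall>s\<in>set [s1, s2, s3, s4, s5, s6]. label s < k" using lab l by simp
    ultimately have "pt X6 = pt X \<longleftrightarrow> closed (fst X) [s1, s2, s3, s4, s5, s6]"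
      using pt_fold_mv_iff[of "fst X" "[s1, s2, s3, s4, s5, s6]" "snd X"] by simp
    also have "\<dots> \<longleftrightarrow> closed 6 [s1, s2, s3, s4, s5, s6]"
      using closed_shift[of 6 "[s1, s2, s3, s4, s5, s6]" "fst X - 6"]
        nonneg_lvl_length[of "[s1, s2, s3, s4, s5, s6]" 6] X by simp
    finally have cl: "pt X6 = pt X \<longleftrightarrow> closed 6 [s1, s2, s3, s4, s5, s6]" .
    have 3: "pt X3 = pt X1 \<longleftrightarrow> s3 = opp s2"
      unfolding Xs(1) X1_X2_def(2) using pt_mv_mv_eq_iff[of X1 s2 s3] lv1 lv2 lab l X1_X2_def(2) by simp
    have 4: "pt X4 = pt X2 \<longleftrightarrow> s4 = opp s3"
      unfolding Xs(2) Xs(1) using pt_mv_mv_eq_iff[of X2 s3 s4] lv2 lvs lab l Xs(1) by simp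
    have 5: "pt X5 = pt X3 \<longleftrightarrow> s5 = opp s4"
      unfolding Xs(3) Xs(2) using pt_mv_mv_eq_iff[of X3 s4 s5] lvs lab l Xs(2) by simp
    \<comment> \<open>In a closed walk, being back at the start after four steps means that the last
      two steps cancel.\<close>
    have 6: "pt X4 = pt X \<longleftrightarrow> s6 = opp s5" if c: "pt X6 = pt X"
    proof
      assume "s6 = opp s5"
      then show "pt X4 = pt X" using c mv_opp[of X4 s5] lvs unfolding Xs(3,4) by simp
    next
      assume "pt X4 = pt X"
      then have "pt (mv s6 (mv s5 X4)) = pt X4" using c unfolding Xs(3,4) by simp
      then show "s6 = opp s5" using pt_mv_mv_eq_iff[of X4 s5 s6] lvs l Xs(3) by simp
    qed
    have 1: "pt X5 = pt X1 \<longleftrightarrow> s1 = opp s6" if c: "pt X6 = pt X"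
    proof -
      have "X5 = mv (opp s6) X6" using mv_opp[of X5 s6] lvs unfolding Xs(4) by simp
      moreover have "pt (mv (opp s6) X6) = pt (mv (opp s6) X)"
        using c X lvs by (intro pt_mv_cong) auto
      ultimately have "pt X5 = pt X1 \<longleftrightarrow> pt (mv (opp s6) X) = pt (mv s1 X)"
        using X1_X2_def(1) by simp
      then show ?thesis using pt_mv_inj[of "opp s6" X s1] X lab l by auto
    qed
    show ?thesis
      unfolding hex_def using cl 1 3 4 5 6 lab l nb by auto
  qed
  show ?thesis
    unfolding X1_X2_def[symmetric]
  proof (intro set_eqI iffI)
    fix p assume "p \<in> hex_ends V E (pt X) (pt X1) (pt X2)"
    then obtain q r where p: "{pt X2, p} \<in> E" "p \<noteq> pt X1" "{p, q} \<in> E" "{q, r} \<in> E" "{r, pt X} \<in> E"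
        "q \<noteq> pt X2" "r \<noteq> p" "q \<noteq> pt X" "r \<noteq> pt X1"
      unfolding hex_ends_def by blast
    have pos: "0 < fst X2" "0 < fst (mv a X2)" "0 < fst (mv b (mv a X2))" "0 < fst (mv c (mv b (mv a X2)))" for a b c
      using lv2 by (auto simp: fst_mv)
    obtain s3 where s3: "label s3 < k" "p = pt (mv s3 X2)"
      by (rule neighbour_lift[OF p(1) pos(1)])
    obtain s4 where s4: "label s4 < k" "q = pt (mv s4 (mv s3 X2))"
      by (rule neighbour_lift[OF p(3)[unfolded s3(2)] pos(2)])
    obtain s5 where s5: "label s5 < k" "r = pt (mv s5 (mv s4 (mv s3 X2)))"
      by (rule neighbour_lift[OF p(4)[unfolded s4(2)] pos(3)])
    obtain s6 where s6: "label s6 < k" "pt X = pt (mv s6 (mv s5 (mv s4 (mv s3 X2))))"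
      by (rule neighbour_lift[OF p(5)[unfolded s5(2)] pos(4)])
    have "hex s1 s2 s3 s4 s5 s6"
      using key[OF s3(1) s4(1) s5(1) s6(1) refl refl refl refl] p s3 s4 s5 s6 by simp
    then show "p \<in> (\<lambda>s3. pt (mv s3 X2)) ` ends s1 s2"
      unfolding ends_def using s3 by blast
  next
    fix p assume "p \<in> (\<lambda>s3. pt (mv s3 X2)) ` ends s1 s2"
    then obtain s3 s4 s5 s6 where p: "p = pt (mv s3 X2)" and h: "hex s1 s2 s3 s4 s5 s6"
      unfolding ends_def by blast
    have l: "label s3 < k" "label s4 < k" "label s5 < k" "label s6 < k"
      using h unfolding hex_def by auto
    define X3 X4 X5 X6 where Xs: "X3 = mv s3 X2" "X4 = mv s4 X3" "X5 = mv s5 X4" "X6 = mv s6 X5"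
    note kk = key[OF l Xs, THEN iffD1, OF h]
    have lvs: "0 < fst X3" "0 < fst X4" "0 < fst X5"
      using lv[of X2 s3] lv[of X3 s4] lv[of X4 s5] lv2 unfolding Xs(1,2,3) by auto
    have "{pt X2, pt X3} \<in> E" "{pt X3, pt X4} \<in> E" "{pt X4, pt X5} \<in> E" "{pt X5, pt X6} \<in> E"
      using edge_mv[OF l(1)] edge_mv[OF l(2)] edge_mv[OF l(3)] edge_mv[OF l(4)] lv2 lvs Xs by simp_all
    then show "p \<in> hex_ends V E (pt X) (pt X1) (pt X2)"
      unfolding hex_ends_def p Xs(1)[symmetric] mem_Collect_eq
      using kk by (intro conjI bexI[of _ "pt X4"] bexI[of _ "pt X5"]) auto
  qed
qed

lemma ends_subset: "ends s1 s2 \<subseteq> Up ` {..<k} \<union> Dn ` {..<k} - {opp s2}"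
proof
  fix s assume "s \<in> ends s1 s2"
  then have "label s < k" "s \<noteq> opp s2" unfolding ends_def hex_def by auto
  then show "s \<in> Up ` {..<k} \<union> Dn ` {..<k} - {opp s2}" by (cases s) auto
qed

lemma finite_ends: "finite (ends s1 s2)"
  using ends_subset by (rule finite_subset) auto

lemma card_hex_ends:
  assumes X: "7 \<le> fst X" and lab: "label s1 < k" "label s2 < k" and nb: "s2 \<noteq> opp s1"
  shows "card (hex_ends V E (pt X) (pt (mv s1 X)) (pt (mv s2 (mv s1 X)))) = card (ends s1 s2)"
proof -
  have "0 < fst (mv s2 (mv s1 X))"
    using X by (auto simp: fst_mv)
  then have "inj_on (\<lambda>s3. pt (mv s3 (mv s2 (mv s1 X)))) (ends s1 s2)"
    by (intro inj_onI) (auto intro: pt_mv_inj simp: ends_def hex_def)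
  then show ?thesis
    unfolding hex_ends_pt[OF assms] by (rule card_image)
qed

end

section \<open>Classification of closed walks of length six\<close>

lemma small_dvd: "int n dvd z \<Longrightarrow> \<bar>z\<bar> < int n \<Longrightarrow> z = 0"
  using dvd_imp_le_int[of z "int n"] by (cases "z = 0") auto

text \<open>
  In the next four lemmas the labels \<open>a, \<dots>, f\<close> belong to the consecutive steps of a closed
  non-backtracking walk, which is determined up to rotation by its pattern of upward and downward
  steps; the coefficients are the powers of two carried by the steps, relative to the lowest level.
\<close>

lemma closed_UUDDUD:
  assumes D: "\<And>i. i \<in> {a, b, c, d, e, f} \<Longrightarrow> int n dvd (if a = i then 1 else 0) + (if b = i then 2 else 0)
      - (if c = i then 2 else 0) - (if d = i then 1 else 0) + (if e = i then 1 else 0) - (if f = i then 1 else 0)"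
    and "5 \<le> n" "b \<noteq> c" "d \<noteq> e" "e \<noteq> f" "f \<noteq> a"
  shows "c = a \<and> e = a \<and> d = b \<and> f = b"
proof -
  \<comment> \<open>Each sum lies between -4 and 4, so a modulus of at least 5 forces it to
    vanish.\<close>
  have Z: "(if a = i then 1 else 0) + (if b = i then 2 else 0)
      - (if c = i then 2 else 0) - (if d = i then 1 else 0) + (if e = i then 1 else 0) - (if f = i then 1 else 0) = (0 :: int)"
    if "i \<in> {a, b, c, d, e, f}" for i
    by (rule small_dvd[OF D[OF that]]) (use assms(2) in auto)
  show ?thesis
    using Z[of a] Z[of b] Z[of c] Z[of d] Z[of e] Z[of f] assms(3-)
    by (auto split: if_splits)
qed

lemma closed_UUDUDD:
  assumes D: "\<And>i. i \<in> {a, b, c, d, e, f} \<Longrightarrow> int n dvd (if a = i then 1 else 0) + (if b = i then 2 else 0)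
      - (if c = i then 2 else 0) + (if d = i then 2 else 0) - (if e = i then 2 else 0) - (if f = i then 1 else 0)"
    and n: "5 \<le> n" "odd n" and "b \<noteq> c" "c \<noteq> d" "d \<noteq> e" "f \<noteq> a"
  shows "n = 5 \<and> b = a \<and> d = a \<and> e = c \<and> f = c"
proof -
  have D5: "a = i \<longrightarrow> n = 5 \<and> b = i \<and> d = i \<and> c \<noteq> i \<and> e \<noteq> i" if ia: "i = a" for i
  proof -
    \<comment> \<open>As \<open>f \<noteq> a\<close>, label \<open>a\<close> receives 1 plus an even
      number between -4 and 4. Of -3, -1, 1, 3, 5 only 5 can be divisible by an \<open>n\<close>
      that is at least 5.\<close>
    define z :: int where "z = (if b = a then 2 else 0) - (if c = a then 2 else 0) + (if d = a then 2 else 0) - (if e = a then 2 else 0)"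
    have "int n dvd 1 + z" using D[of a] \<open>f \<noteq> a\<close> by (simp add: z_def algebra_simps split del: if_split)
    moreover have "z \<in> {-4, -2, 0, 2, 4}" by (auto simp: z_def)
    moreover have "\<not> int n dvd 1" "\<not> int n dvd -1" "\<not> int n dvd 3" "\<not> int n dvd -3"
      using n(1) small_dvd[of n 1] small_dvd[of n "-1"] small_dvd[of n 3] small_dvd[of n "-3"] by auto
    ultimately have "z = 4" by auto
    then have "b = a" "d = a" "c \<noteq> a" "e \<noteq> a" by (auto simp: z_def split: if_splits)
    moreover have "int n dvd 5" using \<open>int n dvd 1 + z\<close> \<open>z = 4\<close> by simp
    then have "n = 5" using n(1) zdvd_imp_le[of "int n" 5] by simp
    ultimately show ?thesis using ia by simp
  qed
  have D5': "n = 5 \<and> c = f \<and> e = f"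
  proof -
    define z :: int where "z = (if b = f then 2 else 0) - (if c = f then 2 else 0) + (if d = f then 2 else 0) - (if e = f then 2 else 0)"
    have "int n dvd - 1 + z" using D[of f] \<open>f \<noteq> a\<close> by (simp add: z_def algebra_simps split del: if_split)
    moreover have "z \<in> {-4, -2, 0, 2, 4}" by (auto simp: z_def)
    moreover have "\<not> int n dvd 1" "\<not> int n dvd -1" "\<not> int n dvd 3" "\<not> int n dvd -3"
      using n(1) small_dvd[of n 1] small_dvd[of n "-1"] small_dvd[of n 3] small_dvd[of n "-3"] by auto
    ultimately have "z = -4" by auto
    then have "c = f" "e = f" by (auto simp: z_def split: if_splits)
    then show ?thesis using D5[of a] by simp
  qed
  show ?thesis using D5[of a] D5' by auto
qed

lemma closed_UUUDDD:
  assumes D: "\<And>i. i \<in> {a, b, c, d, e, f} \<Longrightarrow> int n dvd (if a = i then 1 else 0) + (if b = i then 2 else 0)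
      + (if c = i then 4 else 0) - (if d = i then 4 else 0) - (if e = i then 2 else 0) - (if f = i then 1 else 0)"
    and n: "7 \<le> n" and "c \<noteq> d" "f \<noteq> a"
  shows "n = 7 \<and> a = c \<and> b = c \<and> d \<noteq> c \<and> e = d \<and> f = d"
proof -
  have 1: "n = 7 \<and> a = c \<and> b = c"
  proof -
    \<comment> \<open>Label \<open>c\<close> receives \<open>4 + z\<close> with \<open>z\<close>
      between -3 and 3, a number from 1 to 7; divisibility leaves only 7 = 4 + 2 + 1.\<close>
    define z :: int where "z = (if a = c then 1 else 0) + (if b = c then 2 else 0) - (if e = c then 2 else 0) - (if f = c then 1 else 0)"
    have dv: "int n dvd 4 + z" using D[of c] \<open>c \<noteq> d\<close> by (simp add: z_def algebra_simps split del: if_split)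
    have "z \<in> {-3..3}" by (auto simp: z_def)
    then have "4 + z = 7" using dv zdvd_imp_le[OF dv] n by auto
    moreover from this have "a = c" "b = c" by (auto simp: z_def split: if_splits)
    moreover have "n = 7" using dv zdvd_imp_le[OF dv] \<open>4 + z = 7\<close> n by simp
    ultimately show ?thesis by simp
  qed
  have "e = d \<and> f = d"
  proof -
    define z :: int where "z = (if a = d then 1 else 0) + (if b = d then 2 else 0) - (if e = d then 2 else 0) - (if f = d then 1 else 0)"
    have "int n dvd - 4 + z" using D[of d] \<open>c \<noteq> d\<close> by (simp add: z_def algebra_simps split del: if_split)
    then have "int n dvd - (- 4 + z)" by (simp only: dvd_minus_iff)
    then have dv: "int n dvd 4 - z" by simp
    have "z \<in> {-3..3}" by (auto simp: z_def)
    then have "4 - z = 7" using dv zdvd_imp_le[OF dv] n by auto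
    then show ?thesis by (auto simp: z_def split: if_splits)
  qed
  then show ?thesis using 1 \<open>c \<noteq> d\<close> by auto
qed

lemma closed_UUUDDD_5:
  assumes D: "\<And>i. i \<in> {a, b, c, d, e, f} \<Longrightarrow> int n dvd (if a = i then 1 else 0) + (if b = i then 2 else 0)
      + (if c = i then 4 else 0) - (if d = i then 4 else 0) - (if e = i then 2 else 0) - (if f = i then 1 else 0)"
    and "n = 5" "c \<noteq> d" "f \<noteq> a" "a \<noteq> b" "a \<noteq> c" "b \<noteq> c"
  shows False
  \<comment> \<open>Label \<open>a\<close> can only reach 1 - 4 - 2 = -5, which needs
    \<open>d = a\<close> and \<open>e = a\<close>; then label \<open>b\<close> is left with 2 or
    1.\<close>
  using D[of a] D[of b] D[of c] assms(2-) by (auto split: if_splits)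

section \<open>Level changes divisible by m, and the divisors of 2^m - 1 for m = 3, 4, 6\<close>

context bouwer
begin

text \<open>Six steps change the level by 0, 2, 4 or 6 up to sign; this decides for which
  \<open>m\<close> a nonzero change is a return.\<close>

lemma m_dvd_cases:
  assumes "m > 2"
  shows "m dvd 2 \<longleftrightarrow> False" "m dvd 4 \<longleftrightarrow> m = 4" "m dvd 6 \<longleftrightarrow> m = 3 \<or> m = 6"
proof -
  show "m dvd 2 \<longleftrightarrow> False" using assms dvd_imp_le[of m 2] by auto
  have "m = 3 \<or> m = 4" if "m dvd 4" using dvd_imp_le[OF that] assms by linarith
  then show "m dvd 4 \<longleftrightarrow> m = 4" by auto
  have "m = 3 \<or> m = 4 \<or> m = 5 \<or> m = 6" if "m dvd 6" using dvd_imp_le[OF that] assms by linarith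
  then show "m dvd 6 \<longleftrightarrow> m = 3 \<or> m = 6" by auto
qed

lemma n_dvd: "n dvd 2 ^ m - 1"
  using pow mod_eq_dvd_iff_nat[of 1 "2 ^ m" n] unfolding cong_def by simp

lemma n_cases_m3: "m = 3 \<Longrightarrow> n = 7"
proof -
  assume "m = 3"
  then have d: "n dvd 7" using n_dvd by simp
  then have "n \<le> 7" by (rule dvd_imp_le) simp
  then have "n \<in> {2, 3, 4, 5, 6, 7}" using n by auto
  then show ?thesis using d by auto
qed

lemma n_cases_m4: "m = 4 \<Longrightarrow> n = 3 \<or> n = 5 \<or> n = 15"
proof -
  assume "m = 4"
  then have "n dvd 15" using n_dvd by simp
  then obtain q where q: "15 = n * q" by blast
  show ?thesis
  proof (cases "n \<le> 5")
    case True
    then have "n \<in> {2, 3, 4, 5}" using n by auto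
    then show ?thesis using \<open>n dvd 15\<close> by auto
  next
    case False
    then have "6 \<le> n" by simp
    then have "6 * q \<le> 15" using q by (metis mult_le_mono1)
    then have "q \<in> {0, 1, 2}" by auto
    then show ?thesis using q by auto presburger+
  qed
qed

lemma n_cases_m6: "m = 6 \<Longrightarrow> n = 3 \<or> n = 7 \<or> n = 9 \<or> n = 21 \<or> n = 63"
proof -
  assume "m = 6"
  then have "n dvd 63" using n_dvd by simp
  then obtain q where q: "63 = n * q" by blast
  show ?thesis
  proof (cases "n \<le> 9")
    case True
    then have "n \<in> {2, 3, 4, 5, 6, 7, 8, 9}" using n by auto
    then show ?thesis using \<open>n dvd 63\<close> by auto
  next
    case False
    then have "10 \<le> n" by simp
    then have "10 * q \<le> 63" using q by (metis mult_le_mono1)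
    then have "q \<in> {0, 1, 2, 3, 4, 5, 6}" by auto
    then show ?thesis using q by auto presburger+
  qed
qed

end

context bouwer3
begin

lemma closed_low: "closed 6 ws \<longleftrightarrow> closed c ws" if "nonneg_lvl c ws" "c \<le> 6"
  using closed_shift[OF that(1), of "6 - c"] that(2) by simp

text \<open>The last three steps decide how the level returns: three ups need \<open>m\<close> to
  divide 6, two ups need \<open>m = 4\<close>, a single up would need \<open>m\<close> to divide 2,
  and three downs give the balanced pattern UUUDDD. In the wrapping cases \<open>n\<close> divides
  7, 63 or 15, and few moduli are left to test.\<close>

lemma hex_UUU:
  assumes h: "hex (Up a) (Up b) (Up c) s4 s5 s6"
  shows "9 \<le> n \<Longrightarrow> m = 6 \<and> n = 9 \<or> c = a \<and> (b = a \<or> m = 6 \<and> n = 21)"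
    and "n = 7 \<Longrightarrow> b = a \<and> c = a \<or> (m = 3 \<or> m = 6) \<and> (a = b \<or> b = c \<or> a = c)"
    and "n = 5 \<Longrightarrow> a = b \<or> b = c \<or> a = c"
proof -
  let ?goal = "(9 \<le> n \<longrightarrow> m = 6 \<and> n = 9 \<or> c = a \<and> (b = a \<or> m = 6 \<and> n = 21)) \<and>
    (n = 7 \<longrightarrow> b = a \<and> c = a \<or> (m = 3 \<or> m = 6) \<and> (a = b \<or> b = c \<or> a = c)) \<and>
    (n = 5 \<longrightarrow> a = b \<or> b = c \<or> a = c)"
  have cl: "closed 0 [Up a, Up b, Up c, s4, s5, s6]"
    using h closed_low[of 0 "[Up a, Up b, Up c, s4, s5, s6]"] unfolding hex_def
    by (cases s4; cases s5; cases s6) auto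
  have lab: "{a, b, c, label s4, label s5, label s6} \<subseteq> {..<k}" using h unfolding hex_def by auto
  have D: "\<And>i. i \<in> {a, b, c, label s4, label s5, label s6} \<Longrightarrow> int n dvd disp 0 [Up a, Up b, Up c, s4, s5, s6] i"
    using cl lab unfolding closed_def by auto
  note lv = closed_lvl[OF cl]
  have nb: "s4 \<noteq> Dn c" "s5 \<noteq> opp s4" "s6 \<noteq> opp s5" "Up a \<noteq> opp s6"
    using h unfolding hex_def by auto
  note mc = m_dvd_cases[OF m3]
  have ?goal
  proof (cases s4; cases s5; cases s6)
    fix d e f assume s: "s4 = Up d" "s5 = Up e" "s6 = Up f"
    have "m dvd 6" using lv(1) unfolding s by (simp add: eval_nat_numeral)
    then have "m = 3 \<or> m = 6" using mc by simp
    then have "n = 3 \<or> n = 7 \<or> n = 9 \<and> m = 6 \<or> n = 21 \<and> m = 6 \<or> n = 63" using n_cases_m3 n_cases_m6 by auto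
    \<comment> \<open>For distinct \<open>a\<close>, \<open>b\<close>, \<open>c\<close>, label
      \<open>a\<close> needs 1 + 2 + 4 modulo 7, hence \<open>e = a\<close> and
      \<open>f = a\<close>; label \<open>b\<close> then keeps 2 or 3.\<close>
    moreover have ?goal if "n = 7"
      using D[of a] D[of b] \<open>m = 3 \<or> m = 6\<close> that unfolding s by (auto split: if_splits)
    \<comment> \<open>Among the sums of distinct powers from 1 to 32 that contain 1, only 1 + 4 + 16
      and 63 are divisible by 21, and both contain the 4 of the third step.\<close>
    moreover have ?goal if "n = 21 \<and> m = 6"
      using D[of a] that unfolding s by (auto split: if_splits)
    moreover have ?goal if "n = 63"
      using D[of a] that unfolding s by (auto split: if_splits)
    ultimately show ?goal by auto
  next
    fix d e f assume s: "s4 = Up d" "s5 = Up e" "s6 = Dn f"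
    have "m dvd 4" using lv(1) unfolding s by (simp add: eval_nat_numeral)
    then have "n = 3 \<or> n = 5 \<or> n = 15" using mc n_cases_m4 by simp
    moreover have ?goal if "n = 5"
      using D[of a] D[of b] nb that unfolding s by (auto split: if_splits)
    \<comment> \<open>The label of the only down step differs from both adjacent labels: -16 plus a
      sum of 2, 4, 8 is never divisible by 15. The next two patterns fail for the same
      reason.\<close>
    moreover have ?goal if "n = 15"
      using D[of f] nb that unfolding s by (auto split: if_splits)
    ultimately show ?goal by auto
  next
    fix d e f assume s: "s4 = Up d" "s5 = Dn e" "s6 = Up f"
    have "m dvd 4" using lv(1) unfolding s by (simp add: eval_nat_numeral)
    then have "n = 3 \<or> n = 5 \<or> n = 15" using mc n_cases_m4 by simp
    moreover have ?goal if "n = 5"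
      using D[of a] D[of b] nb that unfolding s by (auto split: if_splits)
    moreover have ?goal if "n = 15"
      using D[of e] nb that unfolding s by (auto split: if_splits)
    ultimately show ?goal by auto
  next
    fix d e f assume s: "s4 = Dn d" "s5 = Up e" "s6 = Up f"
    have "m dvd 4" using lv(1) unfolding s by (simp add: eval_nat_numeral)
    then have "n = 3 \<or> n = 5 \<or> n = 15" using mc n_cases_m4 by simp
    moreover have ?goal if "n = 5"
      using D[of a] D[of b] D[of c] nb that unfolding s by (auto split: if_splits)
    moreover have ?goal if "n = 15"
      using D[of d] nb that unfolding s by (auto split: if_splits)
    ultimately show ?goal by auto
  next
    fix d e f assume s: "s4 = Dn d" "s5 = Dn e" "s6 = Dn f"
    have eq: "disp 0 [Up a, Up b, Up c, s4, s5, s6] i = (if a = i then 1 else 0) + (if b = i then 2 else 0)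
      + (if c = i then 4 else 0) - (if d = i then 4 else 0) - (if e = i then 2 else 0) - (if f = i then 1 else 0)" for i
      unfolding s by simp
    have D': "\<And>i. i \<in> {a, b, c, d, e, f} \<Longrightarrow> int n dvd (if a = i then 1 else 0) + (if b = i then 2 else 0)
      + (if c = i then 4 else 0) - (if d = i then 4 else 0) - (if e = i then 2 else 0) - (if f = i then 1 else 0)"
      using D unfolding eq unfolding s by (simp split del: if_split)
    have "c \<noteq> d" "f \<noteq> a" using nb unfolding s by auto
    have 7: "n = 7 \<and> a = c \<and> b = c" if "7 \<le> n"
      using closed_UUUDDD[OF D' that \<open>c \<noteq> d\<close> \<open>f \<noteq> a\<close>] by blast
    have 5: "a = b \<or> b = c \<or> a = c" if "n = 5"
      using closed_UUUDDD_5[OF D' that \<open>c \<noteq> d\<close> \<open>f \<noteq> a\<close>] by blast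
    show ?goal using 7 5 by simp
  qed (use lv mc in \<open>auto simp: numeral_2_eq_2\<close>)
  then show "9 \<le> n \<Longrightarrow> m = 6 \<and> n = 9 \<or> c = a \<and> (b = a \<or> m = 6 \<and> n = 21)"
    and "n = 7 \<Longrightarrow> b = a \<and> c = a \<or> (m = 3 \<or> m = 6) \<and> (a = b \<or> b = c \<or> a = c)"
    and "n = 5 \<Longrightarrow> a = b \<or> b = c \<or> a = c" by auto
qed

text \<open>Of the possible continuations, UUDDUD gives \<open>c = a\<close>, the rotation UUDDDU of
  UUUDDD gives \<open>n = 7\<close> and \<open>b = a\<close>, UUDUDD would need
  \<open>n = 5\<close>, and UUDUUU would need \<open>n = 15\<close>, where label \<open>c\<close>
  cannot cancel.\<close>

lemma hex_UUD:
  assumes h: "hex (Up a) (Up b) (Dn c) s4 s5 s6" and n7: "7 \<le> n"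
  shows "c = a \<or> n = 7 \<and> b = a"
proof -
  let ?ws = "[Up a, Up b, Dn c, s4, s5, s6]"
  \<comment> \<open>Level 1 leaves room for UUDDDU; the one pattern that would sink lower, UUDDDD,
    has net change -2 and cannot close.\<close>
  have cl: "closed 1 ?ws"
    using h closed_low[of 1 ?ws] closed_lvl[of 6 ?ws] m_dvd_cases[OF m3] unfolding hex_def
    by (cases s4; cases s5; cases s6) auto
  have lab: "{a, b, c, label s4, label s5, label s6} \<subseteq> {..<k}" using h unfolding hex_def by auto
  have D: "\<And>i. i \<in> {a, b, c, label s4, label s5, label s6} \<Longrightarrow> int n dvd disp 1 ?ws i"
    using cl lab unfolding closed_def by auto
  note lv = closed_lvl[OF cl]
  have nb: "b \<noteq> c" "s4 \<noteq> Up c" "s5 \<noteq> opp s4" "s6 \<noteq> opp s5" "Up a \<noteq> opp s6"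
    using h unfolding hex_def by auto
  note mc = m_dvd_cases[OF m3]
  have low: "int n dvd disp 0 ?ws i" if "nonneg_lvl 0 ?ws" "i \<in> {a, b, c, label s4, label s5, label s6}" for i
  proof -
    have "disp 1 ?ws i = 2 ^ 1 * disp 0 ?ws i"
      using disp_shift[OF that(1), of 1 i] by (simp only: add_0)
    then have "int n dvd 2 ^ 1 * disp 0 ?ws i"
      using D[OF that(2)] by (simp only:)
    then show ?thesis by (simp only: dvd_pow2_mult_iff)
  qed
  show ?thesis
  proof (cases s4; cases s5; cases s6)
    fix d e f assume s: "s4 = Up d" "s5 = Up e" "s6 = Up f"
    have "m dvd 4" using lv(1) unfolding s by (simp add: eval_nat_numeral)
    then have "n = 3 \<or> n = 5 \<or> n = 15" using mc n_cases_m4 by simp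
    then have "n = 15" using n7 by auto
    then show ?thesis
      using D[of c] nb unfolding s by (auto split: if_splits)
  next
    fix d e f assume s: "s4 = Up d" "s5 = Dn e" "s6 = Dn f"
    have eq: "disp 0 ?ws i = (if a = i then 1 else 0) + (if b = i then 2 else 0)
      - (if c = i then 2 else 0) + (if d = i then 2 else 0) - (if e = i then 2 else 0) - (if f = i then 1 else 0)" for i
      unfolding s by simp
    have D': "\<And>i. i \<in> {a, b, c, d, e, f} \<Longrightarrow> int n dvd (if a = i then 1 else 0) + (if b = i then 2 else 0)
      - (if c = i then 2 else 0) + (if d = i then 2 else 0) - (if e = i then 2 else 0) - (if f = i then 1 else 0)"
      using low unfolding eq unfolding s by (simp split del: if_split)
    show ?thesis
      using closed_UUDUDD[OF D'] n7 n_odd nb unfolding s by auto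
  next
    fix d e f assume s: "s4 = Dn d" "s5 = Up e" "s6 = Dn f"
    have eq: "disp 0 ?ws i = (if a = i then 1 else 0) + (if b = i then 2 else 0)
      - (if c = i then 2 else 0) - (if d = i then 1 else 0) + (if e = i then 1 else 0) - (if f = i then 1 else 0)" for i
      unfolding s by simp
    have D': "\<And>i. i \<in> {a, b, c, d, e, f} \<Longrightarrow> int n dvd (if a = i then 1 else 0) + (if b = i then 2 else 0)
      - (if c = i then 2 else 0) - (if d = i then 1 else 0) + (if e = i then 1 else 0) - (if f = i then 1 else 0)"
      using low unfolding eq unfolding s by (simp split del: if_split)
    show ?thesis
      using closed_UUDDUD[OF D'] n7 nb unfolding s by auto
  next
    fix d e f assume s: "s4 = Dn d" "s5 = Dn e" "s6 = Up f"
    have eq: "disp 1 ?ws i = (if f = i then 1 else 0) + (if a = i then 2 else 0)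
      + (if b = i then 4 else 0) - (if c = i then 4 else 0) - (if d = i then 2 else 0) - (if e = i then 1 else 0)" for i
      unfolding s by simp
    have D': "\<And>i. i \<in> {f, a, b, c, d, e} \<Longrightarrow> int n dvd (if f = i then 1 else 0) + (if a = i then 2 else 0)
      + (if b = i then 4 else 0) - (if c = i then 4 else 0) - (if d = i then 2 else 0) - (if e = i then 1 else 0)"
      using D unfolding eq unfolding s by (simp split del: if_split) blast
    show ?thesis
      using closed_UUUDDD[OF D'] n7 nb unfolding s by auto
  qed (use lv mc in \<open>auto simp: numeral_2_eq_2\<close>)
qed

text \<open>A walk with a turn has net change at most 4 in absolute value, so for
  \<open>m = 6\<close> it must be balanced. It is then a rotation of one of the three balanced
  patterns, and modulo 9 only UUDDUD survives.\<close>

lemma hex_UDD_9: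
  assumes h: "hex (Up a) (Dn b) (Dn c) s4 s5 s6" and mn: "m = 6" "n = 9"
  shows "c = a"
proof -
  let ?ws = "[Up a, Dn b, Dn c, s4, s5, s6]"
  have cl: "closed 6 ?ws" using h unfolding hex_def by blast
  have lab: "{a, b, c, label s4, label s5, label s6} \<subseteq> {..<k}" using h unfolding hex_def by auto
  have D: "int n dvd disp l ?ws i"
    if "nonneg_lvl l ?ws" "l \<le> 6" "i \<in> {a, b, c, label s4, label s5, label s6}" for i l
  proof -
    have "closed l ?ws" using cl closed_low[OF that(1,2)] by blast
    moreover have "i < k" using lab that(3) by blast
    ultimately show ?thesis unfolding closed_def by blast
  qed
  note lv = closed_lvl[OF cl]
  have mdv: "\<not> m dvd 2" "\<not> m dvd 4" using mn by simp_all
  have nb: "a \<noteq> b" "s4 \<noteq> Up c" "s5 \<noteq> opp s4" "s6 \<noteq> opp s5" "Up a \<noteq> opp s6"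
    using h unfolding hex_def by auto
  show ?thesis
  proof (cases s4; cases s5; cases s6)
    fix d e f assume s: "s4 = Up d" "s5 = Up e" "s6 = Dn f"
    have eq: "disp 1 ?ws i = (if d = i then 1 else 0) + (if e = i then 2 else 0) - (if f = i then 2 else 0)
      + (if a = i then 2 else 0) - (if b = i then 2 else 0) - (if c = i then 1 else 0)" for i
      unfolding s by simp
    have D': "int n dvd (if d = i then 1 else 0) + (if e = i then 2 else 0) - (if f = i then 2 else 0)
      + (if a = i then 2 else 0) - (if b = i then 2 else 0) - (if c = i then 1 else 0)" if "i \<in> {d, e, f, a, b, c}" for i
      using D[of 1 i] that unfolding eq unfolding s by (auto split del: if_split)
    show ?thesis using closed_UUDUDD[OF D'] mn nb unfolding s by auto
  next
    fix d e f assume s: "s4 = Up d" "s5 = Dn e" "s6 = Up f"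
    have eq: "disp 1 ?ws i = (if f = i then 1 else 0) + (if a = i then 2 else 0) - (if b = i then 2 else 0)
      - (if c = i then 1 else 0) + (if d = i then 1 else 0) - (if e = i then 1 else 0)" for i
      unfolding s by simp
    have D': "int n dvd (if f = i then 1 else 0) + (if a = i then 2 else 0) - (if b = i then 2 else 0)
      - (if c = i then 1 else 0) + (if d = i then 1 else 0) - (if e = i then 1 else 0)" if "i \<in> {f, a, b, c, d, e}" for i
      using D[of 1 i] that unfolding eq unfolding s by (auto split del: if_split)
    show ?thesis using closed_UUDDUD[OF D'] mn nb unfolding s by auto
  next
    fix d e f assume s: "s4 = Dn d" "s5 = Up e" "s6 = Up f"
    have eq: "disp 2 ?ws i = (if e = i then 1 else 0) + (if f = i then 2 else 0) + (if a = i then 4 else 0)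
      - (if b = i then 4 else 0) - (if c = i then 2 else 0) - (if d = i then 1 else 0)" for i
      unfolding s by simp
    have D': "int n dvd (if e = i then 1 else 0) + (if f = i then 2 else 0) + (if a = i then 4 else 0)
      - (if b = i then 4 else 0) - (if c = i then 2 else 0) - (if d = i then 1 else 0)" if "i \<in> {e, f, a, b, c, d}" for i
      using D[of 2 i] that unfolding eq unfolding s by (auto split del: if_split)
    show ?thesis using closed_UUUDDD[OF D'] mn nb unfolding s by auto
  qed (use lv mdv in \<open>auto simp: eval_nat_numeral\<close>)
qed

lemma hex_DUU_9:
  assumes h: "hex (Dn a) (Up b) (Up c) s4 s5 s6" and mn: "m = 6" "n = 9"
  shows "c = a"
proof -
  let ?ws = "[Dn a, Up b, Up c, s4, s5, s6]"
  have cl: "closed 6 ?ws" using h unfolding hex_def by blast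
  have lab: "{a, b, c, label s4, label s5, label s6} \<subseteq> {..<k}" using h unfolding hex_def by auto
  have D: "int n dvd disp l ?ws i"
    if "nonneg_lvl l ?ws" "l \<le> 6" "i \<in> {a, b, c, label s4, label s5, label s6}" for i l
  proof -
    have "closed l ?ws" using cl closed_low[OF that(1,2)] by blast
    moreover have "i < k" using lab that(3) by blast
    ultimately show ?thesis unfolding closed_def by blast
  qed
  note lv = closed_lvl[OF cl]
  have mdv: "\<not> m dvd 2" "\<not> m dvd 4" using mn by simp_all
  have nb: "a \<noteq> b" "s4 \<noteq> Dn c" "s5 \<noteq> opp s4" "s6 \<noteq> opp s5" "Dn a \<noteq> opp s6"
    using h unfolding hex_def by auto
  show ?thesis
  proof (cases s4; cases s5; cases s6)
    fix d e f assume s: "s4 = Dn d" "s5 = Dn e" "s6 = Up f"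
    have eq: "disp 1 ?ws i = (if b = i then 1 else 0) + (if c = i then 2 else 0) - (if d = i then 2 else 0)
      - (if e = i then 1 else 0) + (if f = i then 1 else 0) - (if a = i then 1 else 0)" for i
      unfolding s by simp
    have D': "int n dvd (if b = i then 1 else 0) + (if c = i then 2 else 0) - (if d = i then 2 else 0)
      - (if e = i then 1 else 0) + (if f = i then 1 else 0) - (if a = i then 1 else 0)" if "i \<in> {b, c, d, e, f, a}" for i
      using D[of 1 i] that unfolding eq unfolding s by (auto split del: if_split)
    show ?thesis using closed_UUDDUD[OF D'] mn nb unfolding s by auto
  next
    fix d e f assume s: "s4 = Dn d" "s5 = Up e" "s6 = Dn f"
    have eq: "disp 1 ?ws i = (if b = i then 1 else 0) + (if c = i then 2 else 0) - (if d = i then 2 else 0)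
      + (if e = i then 2 else 0) - (if f = i then 2 else 0) - (if a = i then 1 else 0)" for i
      unfolding s by simp
    have D': "int n dvd (if b = i then 1 else 0) + (if c = i then 2 else 0) - (if d = i then 2 else 0)
      + (if e = i then 2 else 0) - (if f = i then 2 else 0) - (if a = i then 1 else 0)" if "i \<in> {b, c, d, e, f, a}" for i
      using D[of 1 i] that unfolding eq unfolding s by (auto split del: if_split)
    show ?thesis using closed_UUDUDD[OF D'] mn nb unfolding s by auto
  next
    fix d e f assume s: "s4 = Up d" "s5 = Dn e" "s6 = Dn f"
    have eq: "disp 1 ?ws i = (if b = i then 1 else 0) + (if c = i then 2 else 0) + (if d = i then 4 else 0)
      - (if e = i then 4 else 0) - (if f = i then 2 else 0) - (if a = i then 1 else 0)" for i
      unfolding s by simp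
    have D': "int n dvd (if b = i then 1 else 0) + (if c = i then 2 else 0) + (if d = i then 4 else 0)
      - (if e = i then 4 else 0) - (if f = i then 2 else 0) - (if a = i then 1 else 0)" if "i \<in> {b, c, d, e, f, a}" for i
      using D[of 1 i] that unfolding eq unfolding s by (auto split del: if_split)
    show ?thesis using closed_UUUDDD[OF D'] mn nb unfolding s by auto
  qed (use lv mdv in \<open>auto simp: eval_nat_numeral\<close>)
qed

section \<open>Explicit closed walks and the resulting counts of third steps\<close>

lemma closedI:
  assumes "nonneg_lvl c ws" "c \<le> 6" "lvl c ws = c" "\<And>i. int n dvd disp c ws i"
  shows "closed 6 ws"
proof -
  have "closed c ws" unfolding closed_def using assms(3,4) by simp
  then show ?thesis using closed_low[OF assms(1,2)] by blast
qed

text \<open>All steps run between the same two levels, so each label cancels against itself.\<close>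

lemma hex_alternating:
  assumes "i < k" "j < k" "l < k" "i \<noteq> j" "l \<noteq> j" "l \<noteq> i"
  shows "hex (Up i) (Dn j) (Up l) (Dn i) (Up j) (Dn l)" "hex (Dn i) (Up j) (Dn l) (Up i) (Dn j) (Up l)"
  using assms by (intro hexI closedI[of 1]; simp)+

text \<open>Rotations of one closed walk, with \<open>i\<close> and \<open>j\<close> possibly
  exchanged. They provide \<open>Dn i\<close> after \<open>Up i\<close>, \<open>Up j\<close>, and
  both steps with label \<open>i\<close> after a path that turns.\<close>

lemma hex_generic:
  assumes "i < k" "j < k" "i \<noteq> j"
  shows "hex (Up i) (Up j) (Dn i) (Dn j) (Up i) (Dn j)"
    and "hex (Up i) (Dn j) (Up i) (Up j) (Dn i) (Dn j)"
    and "hex (Up i) (Dn j) (Dn i) (Up j) (Dn i) (Up j)"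
    and "hex (Dn i) (Up j) (Dn i) (Up j) (Up i) (Dn j)"
    and "hex (Dn i) (Up j) (Up i) (Dn j) (Dn i) (Up j)"
  using assms by (intro hexI closedI[of 1]; simp)+

text \<open>Each label is used on three consecutive levels in one direction, and 1 + 2 + 4 =
  7.\<close>

lemma hex_7:
  assumes "i < k" "j < k" "i \<noteq> j" "n = 7"
  shows "hex (Up i) (Dn j) (Dn j) (Dn j) (Up i) (Up i)" "hex (Dn i) (Up j) (Up j) (Up j) (Dn i) (Dn i)"
  using assms by (intro hexI closedI[of 3]; simp)+

text \<open>Labels \<open>i\<close> and \<open>j\<close> are used on the outer two of three
  consecutive levels, and 1 + 4 = 5; the middle level carries \<open>l\<close> once up and once
  down, so \<open>l\<close> is arbitrary.\<close>

lemma hex_5: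
  assumes "i < k" "j < k" "l < k" "i \<noteq> j" "n = 5"
  shows "hex (Up i) (Dn j) (Dn l) (Dn j) (Up i) (Up l)" "hex (Dn i) (Up j) (Up l) (Up j) (Dn i) (Dn l)"
  using assms by (intro hexI closedI[of 3]; simp)+

text \<open>Each label occurs at two levels that differ by 3, and 1 + 8 = 9; six up steps return to
  the same level modulo 6.\<close>

lemma hex_9:
  assumes "i < k" "j < k" "l < k" "m = 6" "n = 9"
  shows "hex (Up i) (Up j) (Up l) (Up i) (Up j) (Up l)"
proof (rule hexI)
  let ?ws = "[Up i, Up j, Up l, Up i, Up j, Up l]"
  show "closed 6 ?ws"
  proof -
    have "lvl 0 ?ws = 6" by (simp add: eval_nat_numeral)
    moreover have "9 dvd disp 0 ?ws x" for x by simp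
    ultimately have "closed 0 ?ws" unfolding closed_def using assms(4,5) by simp
    then show ?thesis using closed_low[of 0 ?ws] by simp
  qed
qed (use assms in auto)

lemma endsI: "hex s1 s2 s3 s4 s5 s6 \<Longrightarrow> s3 \<in> ends s1 s2"
  unfolding ends_def by blast

lemma card_Up_Dn: "card (Up ` A) = card A" "card (Dn ` A) = card A"
  by (auto intro!: card_image inj_onI)

text \<open>These third steps exist for every modulus: the alternating walk needs a third label, and
  the generic walk supplies label \<open>i\<close>.\<close>

lemma ends_source_sink:
  assumes "i < k" "j < k" "i \<noteq> j"
  shows "insert (Dn i) (Up ` ({..<k} - {j})) \<subseteq> ends (Up i) (Dn j)"
    and "insert (Up i) (Dn ` ({..<k} - {j})) \<subseteq> ends (Dn i) (Up j)"
proof -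
  have "Up l \<in> ends (Up i) (Dn j)" "Dn l \<in> ends (Dn i) (Up j)" if "l < k" "l \<noteq> j" for l
    using hex_alternating[of i j l] hex_generic[OF assms] assms that
    by (cases "l = i"; blast intro: endsI)+
  then show "insert (Dn i) (Up ` ({..<k} - {j})) \<subseteq> ends (Up i) (Dn j)"
    and "insert (Up i) (Dn ` ({..<k} - {j})) \<subseteq> ends (Dn i) (Up j)"
    using hex_generic[OF assms] by (auto intro: endsI)
qed

lemma card_insert_steps:
  assumes "j < k"
  shows "card (insert (Dn i) (Up ` ({..<k} - {j}))) = k" "card (insert (Up i) (Dn ` ({..<k} - {j}))) = k"
proof -
  have "card (insert (Dn i) (Up ` ({..<k} - {j}))) = Suc (card (Up ` ({..<k} - {j})))"
    by (intro card_insert_disjoint) auto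
  then show "card (insert (Dn i) (Up ` ({..<k} - {j}))) = k"
    using assms by (simp add: card_Up_Dn)
  have "card (insert (Up i) (Dn ` ({..<k} - {j}))) = Suc (card (Dn ` ({..<k} - {j})))"
    by (intro card_insert_disjoint) auto
  then show "card (insert (Up i) (Dn ` ({..<k} - {j}))) = k"
    using assms by (simp add: card_Up_Dn)
qed

lemma card_ends_source_sink:
  assumes "i < k" "j < k" "i \<noteq> j"
  shows "k \<le> card (ends (Up i) (Dn j))" "k \<le> card (ends (Dn i) (Up j))"
  using card_mono[OF finite_ends ends_source_sink(1)[OF assms]]
    card_mono[OF finite_ends ends_source_sink(2)[OF assms]] card_insert_steps[OF assms(2)] by auto

lemma card_ends_source_sink_7:
  assumes "i < k" "j < k" "i \<noteq> j" "n = 7"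
  shows "k + 1 \<le> card (ends (Up i) (Dn j))" "k + 1 \<le> card (ends (Dn i) (Up j))"
proof -
  have "insert (Dn j) (insert (Dn i) (Up ` ({..<k} - {j}))) \<subseteq> ends (Up i) (Dn j)"
    using ends_source_sink(1)[OF assms(1-3)] hex_7[OF assms] by (auto intro: endsI)
  from card_mono[OF finite_ends this] show "k + 1 \<le> card (ends (Up i) (Dn j))"
    using assms card_insert_steps(1)[of j i] by (subst (asm) card_insert_disjoint) auto
  have "insert (Up j) (insert (Up i) (Dn ` ({..<k} - {j}))) \<subseteq> ends (Dn i) (Up j)"
    using ends_source_sink(2)[OF assms(1-3)] hex_7[OF assms] by (auto intro: endsI)
  from card_mono[OF finite_ends this] show "k + 1 \<le> card (ends (Dn i) (Up j))"
    using assms card_insert_steps(2)[of j i] by (subst (asm) card_insert_disjoint) auto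
qed

text \<open>The largest possible count: modulo 5 every third step that does not backtrack
  occurs.\<close>

lemma card_ends_source_sink_5:
  assumes "i < k" "j < k" "i \<noteq> j" "n = 5"
  shows "2 * k - 1 \<le> card (ends (Up i) (Dn j))" "2 * k - 1 \<le> card (ends (Dn i) (Up j))"
proof -
  have "Dn ` {..<k} \<union> Up ` ({..<k} - {j}) \<subseteq> ends (Up i) (Dn j)"
    using ends_source_sink(1)[OF assms(1-3)] hex_5(1)[OF assms(1,2) _ assms(3,4)] by (auto intro: endsI)
  from card_mono[OF finite_ends this] show "2 * k - 1 \<le> card (ends (Up i) (Dn j))"
    using assms by (subst (asm) card_Un_disjoint) (auto simp: card_Up_Dn)
  have "Up ` {..<k} \<union> Dn ` ({..<k} - {j}) \<subseteq> ends (Dn i) (Up j)"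
    using ends_source_sink(2)[OF assms(1-3)] hex_5(2)[OF assms(1,2) _ assms(3,4)] by (auto intro: endsI)
  from card_mono[OF finite_ends this] show "2 * k - 1 \<le> card (ends (Dn i) (Up j))"
    using assms by (subst (asm) card_Un_disjoint) (auto simp: card_Up_Dn)
qed

lemma card_ends_source_sink_9:
  assumes "i < k" "j < k" "i \<noteq> j" "m = 6" "n = 9"
  shows "card (ends (Up i) (Dn j)) \<le> k" "card (ends (Dn i) (Up j)) \<le> k"
proof -
  have "ends (Up i) (Dn j) \<subseteq> insert (Dn i) (Up ` ({..<k} - {j}))"
  proof
    fix s assume s: "s \<in> ends (Up i) (Dn j)"
    then have "s \<in> Up ` {..<k} \<union> Dn ` {..<k} - {Up j}" using ends_subset by fastforce
    then show "s \<in> insert (Dn i) (Up ` ({..<k} - {j}))"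
      using s hex_UDD_9[OF _ assms(4,5)] unfolding ends_def by auto
  qed
  from card_mono[OF _ this] show "card (ends (Up i) (Dn j)) \<le> k"
    using card_insert_steps(1)[OF assms(2)] by simp
  have "ends (Dn i) (Up j) \<subseteq> insert (Up i) (Dn ` ({..<k} - {j}))"
  proof
    fix s assume s: "s \<in> ends (Dn i) (Up j)"
    then have "s \<in> Up ` {..<k} \<union> Dn ` {..<k} - {Dn j}" using ends_subset by fastforce
    then show "s \<in> insert (Up i) (Dn ` ({..<k} - {j}))"
      using s hex_DUU_9[OF _ assms(4,5)] unfolding ends_def by auto
  qed
  from card_mono[OF _ this] show "card (ends (Dn i) (Up j)) \<le> k"
    using card_insert_steps(2)[OF assms(2)] by simp
qed

lemma ends_UU_cases:
  assumes "s \<in> ends (Up i) (Up j)"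
  obtains l s4 s5 s6 where "s = Up l" "l < k" "hex (Up i) (Up j) (Up l) s4 s5 s6"
  | l s4 s5 s6 where "s = Dn l" "l < k" "l \<noteq> j" "hex (Up i) (Up j) (Dn l) s4 s5 s6"
proof -
  obtain s4 s5 s6 where h: "hex (Up i) (Up j) s s4 s5 s6" using assms unfolding ends_def by blast
  show ?thesis
  proof (cases s)
    case (Up l)
    then show ?thesis using that(1) h unfolding hex_def by auto
  next
    case (Dn l)
    then have "l < k" "l \<noteq> j" using h unfolding hex_def by auto
    then show ?thesis using that(2) h Dn by auto
  qed
qed

text \<open>Distinct labels leave only \<open>Dn i\<close>, equal labels only \<open>Up i\<close>.
  For \<open>m = 6\<close> and \<open>n = 21\<close> both \<open>Up i\<close> and
  \<open>Dn i\<close> may occur after distinct labels, and two is below \<open>k\<close> only if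
  \<open>k > 2\<close>.\<close>

lemma card_ends_UU_ge9:
  assumes "9 \<le> n" "\<not> (m = 6 \<and> n = 9)" "2 < k \<or> \<not> (m = 6 \<and> n = 21)"
  shows "card (ends (Up i) (Up j)) < k"
proof (cases "i = j \<or> m = 6 \<and> n = 21")
  case False
  then have "ends (Up i) (Up j) \<subseteq> {Dn i}"
    using hex_UUU(1) hex_UUD assms by (fastforce elim!: ends_UU_cases)
  from card_mono[OF _ this] show ?thesis using k by simp
next
  case True
  show ?thesis
  proof (cases "i = j")
    case True
    then have "ends (Up i) (Up j) \<subseteq> {Up i}"
      using hex_UUU(1) hex_UUD assms by (fastforce elim!: ends_UU_cases)
    from card_mono[OF _ this] show ?thesis using k by simp
  next
    case False
    have "ends (Up i) (Up j) \<subseteq> {Up i, Dn i}"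
      using hex_UUU(1) hex_UUD assms by (fastforce elim!: ends_UU_cases)
    from card_mono[OF _ this] show ?thesis using True False assms(3) by simp
  qed
qed

text \<open>For \<open>m\<close> equal to 3 or 6 there can be three ends, which is below
  \<open>k + 1\<close> only if \<open>k > 2\<close>; otherwise \<open>Dn i\<close> alone is
  possible.\<close>

lemma card_ends_UU_7:
  assumes "n = 7" "i \<noteq> j" "2 < k \<or> m \<noteq> 3 \<and> m \<noteq> 6"
  shows "card (ends (Up i) (Up j)) < k + 1"
proof (cases "m = 3 \<or> m = 6")
  case True
  have "ends (Up i) (Up j) \<subseteq> {Up i, Up j, Dn i}"
  proof
    fix s assume "s \<in> ends (Up i) (Up j)"
    then show "s \<in> {Up i, Up j, Dn i}"
    proof (cases rule: ends_UU_cases)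
      case (1 l s4 s5 s6)
      then show ?thesis using hex_UUU(2)[OF 1(3) assms(1)] assms(2) by auto
    next
      case (2 l s4 s5 s6)
      then show ?thesis using hex_UUD[OF 2(4)] assms by auto
    qed
  qed
  from card_mono[OF _ this] show ?thesis using True assms by (auto simp: card_insert_if split: if_splits)
next
  case False
  have "ends (Up i) (Up j) \<subseteq> {Dn i}"
  proof
    fix s assume "s \<in> ends (Up i) (Up j)"
    then show "s \<in> {Dn i}"
    proof (cases rule: ends_UU_cases)
      case (1 l s4 s5 s6)
      then show ?thesis using hex_UUU(2)[OF 1(3) assms(1)] assms(2) False by auto
    next
      case (2 l s4 s5 s6)
      then show ?thesis using hex_UUD[OF 2(4)] assms by auto
    qed
  qed
  from card_mono[OF _ this] show ?thesis using k by simp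
qed

lemma card_ends_UU_straight_7:
  assumes "n = 7" "m \<noteq> 3" "m \<noteq> 6" "i < k"
  shows "card (ends (Up i) (Up i)) < k + 1"
proof -
  have "ends (Up i) (Up i) \<subseteq> insert (Up i) (Dn ` ({..<k} - {i}))"
  proof
    fix s assume "s \<in> ends (Up i) (Up i)"
    then show "s \<in> insert (Up i) (Dn ` ({..<k} - {i}))"
    proof (cases rule: ends_UU_cases)
      case (1 l s4 s5 s6)
      then show ?thesis using hex_UUU(2)[OF 1(3) assms(1)] assms(2,3) by auto
    next
      case (2 l s4 s5 s6)
      then show ?thesis  by auto
    qed
  qed
  from card_mono[OF _ this] show ?thesis using card_insert_steps(2)[OF assms(4)] by simp
qed

text \<open>A label other than \<open>i\<close> and \<open>j\<close> yields an up step that is not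
  an end, so the maximum of \<open>2 * k - 1\<close> is missed.\<close>

lemma card_ends_UU_5:
  assumes "n = 5" "i \<noteq> j" "i < k" "j < k" "2 < k"
  shows "card (ends (Up i) (Up j)) < 2 * k - 1"
proof -
  have "\<exists>l<3. l \<noteq> i \<and> l \<noteq> j" by presburger
  then obtain l where "l < 3" and l': "l \<noteq> i" "l \<noteq> j" by blast
  then have l: "l < k" "l \<noteq> i" "l \<noteq> j" using assms(5) by simp_all
  then have "Up l \<notin> ends (Up i) (Up j)"
    using hex_UUU(3)[OF _ assms(1)] assms(2) unfolding ends_def by blast
  then have "ends (Up i) (Up j) \<subseteq> Up ` ({..<k} - {l}) \<union> Dn ` ({..<k} - {j})"
    using ends_subset[of "Up i" "Up j"] by fastforce
  from card_mono[OF _ this]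
  have "card (ends (Up i) (Up j)) \<le> card (Up ` ({..<k} - {l}) \<union> Dn ` ({..<k} - {j}))" by simp
  also have "\<dots> \<le> card (Up ` ({..<k} - {l})) + card (Dn ` ({..<k} - {j}))" by (rule card_Un_le)
  also have "\<dots> = (k - 1) + (k - 1)" using l assms(4) by (simp add: card_Up_Dn)
  finally have "card (ends (Up i) (Up j)) \<le> (k - 1) + (k - 1)" .
  then show ?thesis using k by simp
qed

text \<open>Here the comparison with turning paths is reversed: six up steps wrap around with any
  third label.\<close>

lemma card_ends_UU_9:
  assumes "m = 6" "n = 9" "i \<noteq> j" "i < k" "j < k"
  shows "k < card (ends (Up i) (Up j))"
proof -
  have "insert (Dn i) (Up ` {..<k}) \<subseteq> ends (Up i) (Up j)"
    using hex_9[OF assms(4,5) _ assms(1,2)] hex_generic[OF assms(4,5,3)] by (auto intro: endsI)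
  from card_mono[OF finite_ends this] show ?thesis
    by (subst (asm) card_insert_disjoint) (auto simp: card_Up_Dn)
qed

end

section \<open>Automorphisms respect the orientation\<close>

text \<open>
  For a suitable set \<open>T\<close> of cardinalities, \<open>apart T v x y\<close> forces exactly one of \<open>x\<close> and \<open>y\<close> to be
  an out-neighbour of \<open>v\<close>, so that \<open>same_side\<close> recovers the partition into in- and out-neighbours.
\<close>

definition apart :: "nat set \<Rightarrow> 'a set \<Rightarrow> 'a set set \<Rightarrow> 'a \<Rightarrow> 'a \<Rightarrow> 'a \<Rightarrow> bool" where
  "apart T V E v x y \<longleftrightarrow> card (hex_ends V E x v y) \<in> T \<or> card (hex_ends V E y v x) \<in> T"

definition same_side :: "nat set \<Rightarrow> 'a set \<Rightarrow> 'a set set \<Rightarrow> 'a \<Rightarrow> 'a \<Rightarrow> 'a \<Rightarrow> bool" where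
  "same_side T V E v x y \<longleftrightarrow>
     (\<exists>z\<in>V. {v, z} \<in> E \<and> z \<noteq> x \<and> z \<noteq> y \<and> apart T V E v x z \<and> apart T V E v y z)"

lemma same_side_automorphism:
  assumes f: "graph_automorphism V E f" and V: "v \<in> V" "x \<in> V" "y \<in> V"
  shows "same_side T V E (f v) (f x) (f y) \<longleftrightarrow> same_side T V E v x y"
proof -
  have ap: "apart T V E (f v) (f x) (f z) \<longleftrightarrow> apart T V E v x z" if "x \<in> V" "z \<in> V" for x z
    unfolding apart_def using card_hex_ends_automorphism[OF f] V that by simp
  have "(\<exists>z\<in>V. P z) \<longleftrightarrow> (\<exists>z\<in>V. P (f z))" for P
    using graph_automorphism_surj[OF f] graph_automorphism_in[OF f] by metis
  note ex = this
  show ?thesis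
    unfolding same_side_def
    by (subst ex)
      (use V in \<open>auto simp: ap graph_automorphism_edge[OF f] graph_automorphism_inj[OF f]\<close>)
qed

context bouwer3
begin

lemma card_hex_ends_mv:
  assumes "8 \<le> fst X" "label s < k" "label t < k" "s \<noteq> t"
  shows "card (hex_ends V E (pt (mv s X)) (pt X) (pt (mv t X))) = card (ends (opp s) t)"
proof -
  have "mv (opp s) (mv s X) = X" using assms by (intro mv_opp) simp
  moreover have "7 \<le> fst (mv s X)" using assms(1) by (auto simp: fst_mv)
  ultimately show ?thesis
    using card_hex_ends[of "mv s X" "opp s" t] assms by simp
qed

text \<open>\<open>T\<close> must contain no count of a turning path and every count of an upward
  path with two labels. With a third label available, two neighbours on one side can be compared
  through a neighbour that shares no label with them; for \<open>k = 2\<close> paths with equal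
  labels have to be counted too.\<close>

lemma not_arc_transitive:
  assumes n5: "5 \<le> n" and kn: "2 < k \<or> n \<noteq> 5"
    and anchor: "\<And>i j. i < k \<Longrightarrow> j < k \<Longrightarrow> i \<noteq> j \<Longrightarrow> card (ends (Up i) (Dn j)) \<notin> T \<and> card (ends (Dn i) (Up j)) \<notin> T"
    and directed: "\<And>i j. i < k \<Longrightarrow> j < k \<Longrightarrow> i \<noteq> j \<Longrightarrow> card (ends (Up i) (Up j)) \<in> T"
    and straight: "2 < k \<or> (\<forall>i<k. card (ends (Up i) (Up i)) \<in> T)"
  shows "\<not> arc_transitive V E"
proof
  assume at: "arc_transitive V E"
  have ap: "apart T V E (pt X) (pt (mv s X)) (pt (mv t X)) \<longleftrightarrow>
      card (ends (opp s) t) \<in> T \<or> card (ends (opp t) s) \<in> T"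
    if "8 \<le> fst X" "label s < k" "label t < k" "s \<noteq> t" for X s t
    unfolding apart_def using card_hex_ends_mv that by simp
  have ap1: "is_up s \<noteq> is_up t"
    if "card (ends (opp s) t) \<in> T \<or> card (ends (opp t) s) \<in> T" "label s < k" "label t < k" "s \<noteq> t" for s t
    using that anchor by (cases s; cases t) auto
  have UU: "card (ends (Up i) (Up j)) \<in> T" if "i < k" "j < k" "i \<noteq> j \<or> k \<le> 2" for i j
    using that directed straight by (cases "i = j") auto
  have ap2: "card (ends (opp s) t) \<in> T \<or> card (ends (opp t) s) \<in> T"
    if "is_up s \<noteq> is_up t" "label s < k" "label t < k" "label s \<noteq> label t \<or> k \<le> 2" for s t
    using that UU by (cases s; cases t) auto
  have same: "same_side T V E (pt X) (pt (mv s X)) (pt (mv t X)) \<longleftrightarrow> is_up s = is_up t"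
    if X: "8 \<le> fst X" and l: "label s < k" "label t < k" for X s t
  proof
    assume "same_side T V E (pt X) (pt (mv s X)) (pt (mv t X))"
    then obtain z where z: "{pt X, z} \<in> E" "z \<noteq> pt (mv s X)" "z \<noteq> pt (mv t X)"
      "apart T V E (pt X) (pt (mv s X)) z" "apart T V E (pt X) (pt (mv t X)) z"
      unfolding same_side_def by blast
    have "0 < fst X" using X by simp
    obtain u where u: "label u < k" "z = pt (mv u X)"
      by (rule neighbour_lift[OF z(1) \<open>0 < fst X\<close>])
    have "s \<noteq> u" "t \<noteq> u" using z u by auto
    then have "is_up s \<noteq> is_up u" "is_up t \<noteq> is_up u"
      using ap1[OF _ l(1) u(1)] ap1[OF _ l(2) u(1)] ap[OF X l(1) u(1)] ap[OF X l(2) u(1)] z(4,5) u(2) by blast+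
    then show "is_up s = is_up t" by auto
  next
    assume st: "is_up s = is_up t"
    \<comment> \<open>The comparison neighbour lies on the other side and avoids both labels where
      possible.\<close>
    obtain c where c: "c < k" "(c \<noteq> label s \<and> c \<noteq> label t) \<or> k \<le> 2"
    proof (cases "k \<le> 2")
      case True
      then show ?thesis using that[of 0] k by simp
    next
      case False
      have "\<exists>c<3. c \<noteq> label s \<and> c \<noteq> label t" by presburger
      then obtain c where "c < 3" "c \<noteq> label s \<and> c \<noteq> label t" by blast
      then show ?thesis using that[of c] False by simp
    qed
    define u where "u = (if is_up s then Dn c else Up c)"
    have u: "label u < k" "is_up u \<noteq> is_up s" "is_up u \<noteq> is_up t" "label u = c"
      unfolding u_def using c st by auto
    have "apart T V E (pt X) (pt (mv s X)) (pt (mv u X))" "apart T V E (pt X) (pt (mv t X)) (pt (mv u X))"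
    proof -
      have "s \<noteq> u" "t \<noteq> u" using u(2,3) by auto
      moreover have "card (ends (opp s) u) \<in> T \<or> card (ends (opp u) s) \<in> T"
        using u l c by (intro ap2) auto
      moreover have "card (ends (opp t) u) \<in> T \<or> card (ends (opp u) t) \<in> T"
        using u l c by (intro ap2) auto
      ultimately show "apart T V E (pt X) (pt (mv s X)) (pt (mv u X))" "apart T V E (pt X) (pt (mv t X)) (pt (mv u X))"
        using ap[OF X l(1) u(1)] ap[OF X l(2) u(1)] by blast+
    qed
    moreover have "{pt X, pt (mv u X)} \<in> E" using edge_mv[OF u(1)] X by simp
    moreover have "pt (mv u X) \<noteq> pt (mv s X)" "pt (mv u X) \<noteq> pt (mv t X)"
      using pt_mv_inj[of u X s] pt_mv_inj[of u X t] X u l by auto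
    ultimately show "same_side T V E (pt X) (pt (mv s X)) (pt (mv t X))"
      unfolding same_side_def by (intro bexI[of _ "pt (mv u X)"]) auto
  qed

  \<comment> \<open>Level 20 keeps the walk below and its image at levels of at least 19, well above
    the bound 8 of \<open>same\<close>.\<close>
  define X0 :: "nat \<times> (nat \<Rightarrow> int)" where "X0 = (20, \<lambda>_. 0)"
  define Y0 where "Y0 = mv (Up 0) X0"
  have k0: "0 < k" "1 < k" using k by auto
  have "{pt X0, pt Y0} \<in> E" unfolding Y0_def using edge_up k0 by blast
  then have "(pt X0, pt Y0) \<in> arcs V E" "(pt Y0, pt X0) \<in> arcs V E"
    unfolding arcs_def by (auto simp: insert_commute)
  then obtain f where f: "graph_automorphism V E f" and f0: "f (pt X0) = pt Y0" "f (pt Y0) = pt X0"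
    using at unfolding arc_transitive_def by fast

  define flips where "flips X Y t t' \<longleftrightarrow> label t' < k \<and> f (pt (mv t X)) = pt (mv t' Y) \<and> is_up t' \<noteq> is_up t" for X Y t t'
  \<comment> \<open>Since \<open>f\<close> preserves \<open>same_side\<close>, one reversed step at
    a vertex reverses all steps there.\<close>
  have step: "\<exists>t'. flips X Y t t'"
    if lv: "8 \<le> fst X" "8 \<le> fst Y" and fX: "f (pt X) = pt Y" and fl: "flips X Y s s'" and l: "label s < k" "label t < k" for X Y s s' t
  proof -
    have "{pt X, pt (mv t X)} \<in> E" using edge_mv l lv by simp
    then have e: "{pt Y, f (pt (mv t X))} \<in> E"
      unfolding fX[symmetric] using graph_automorphism_edge[OF f] by simp
    have "0 < fst Y" using lv by simp
    obtain t' where t': "label t' < k" "f (pt (mv t X)) = pt (mv t' Y)"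
      by (rule neighbour_lift[OF e \<open>0 < fst Y\<close>])
    have "is_up s = is_up t \<longleftrightarrow> same_side T V E (pt X) (pt (mv s X)) (pt (mv t X))"
      using same l lv by simp
    also have "\<dots> \<longleftrightarrow> same_side T V E (f (pt X)) (f (pt (mv s X))) (f (pt (mv t X)))"
      using same_side_automorphism[OF f] by simp
    also have "\<dots> \<longleftrightarrow> is_up s' = is_up t'"
      using same[of Y s' t'] fl t' lv fX unfolding flips_def by simp
    finally show ?thesis using fl t' unfolding flips_def by (intro exI[of _ t']) auto
  qed
  \<comment> \<open>A reversed step is also reversed when read from its other end, which carries the
    reversal on to the next vertex.\<close>
  have return: "flips (mv t X) (mv t' Y) (opp t) (opp t')"
    if "1 \<le> fst X" "1 \<le> fst Y" "f (pt X) = pt Y" "flips X Y t t'" for X Y t t'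
    using that mv_opp[of X t] mv_opp[of Y t'] unfolding flips_def by auto
  have turn: "t2' = opp t1' \<longleftrightarrow> t2 = opp t1"
    if "2 \<le> fst X" "2 \<le> fst Y" "f (pt X) = pt Y" "label t1 < k" "label t2 < k"
      "flips X Y t1 t1'" "flips (mv t1 X) (mv t1' Y) t2 t2'" for X Y t1 t1' t2 t2'
  proof -
    have lv: "0 < fst X" "0 < fst Y" "0 < fst (mv t1 X)" "0 < fst (mv t1' Y)"
      using that(1,2) by (auto simp: fst_mv)
    have "t2' = opp t1' \<longleftrightarrow> pt (mv t2' (mv t1' Y)) = pt Y"
      using pt_mv_mv_eq_iff[OF lv(2,4)] that unfolding flips_def by simp
    also have "\<dots> \<longleftrightarrow> f (pt (mv t2 (mv t1 X))) = f (pt X)"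
      using that unfolding flips_def by simp
    also have "\<dots> \<longleftrightarrow> pt (mv t2 (mv t1 X)) = pt X"
      using graph_automorphism_inj[OF f] by simp
    also have "\<dots> \<longleftrightarrow> t2 = opp t1"
      using pt_mv_mv_eq_iff[OF lv(1,3)] that by simp
    finally show ?thesis .
  qed
  \<comment> \<open>The walk \<open>U\<^sub>0 U\<^sub>j D\<^sub>0 D\<^sub>j U\<^sub>0 D\<^sub>j\<close> is closed; its image has the reversed pattern.\<close>
  have main: "n = 5 \<and> f (pt (mv (Up j) (mv (Up 0) X0))) = pt (mv (Dn 0) (mv (Dn 0) Y0))"
    if j: "j < k" "j \<noteq> 0" for j
  proof -
    define X1 X2 X3 X4 X5 where Xs: "X1 = mv (Up 0) X0" "X2 = mv (Up j) X1" "X3 = mv (Dn 0) X2"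
      "X4 = mv (Dn j) X3" "X5 = mv (Up 0) X4"
    have X6: "mv (Dn j) X5 = X0"
      using j unfolding Xs X0_def by (auto simp: fun_eq_iff)
    have lX: "fst X0 = 20" "fst X1 = 21" "fst X2 = 22" "fst X3 = 21" "fst X4 = 20" "fst X5 = 21"
      unfolding Xs X0_def by simp_all
    have lY0: "fst Y0 = 21" unfolding Y0_def X0_def by simp
    have f1: "flips X0 Y0 (Up 0) (Dn 0)"
    proof -
      have "mv (Dn 0) Y0 = X0" unfolding Y0_def using mv_opp[of X0 "Up 0"] lX by simp
      then show ?thesis unfolding flips_def using f0 k0 by (simp add: Y0_def[symmetric])
    qed
    define Y1 where "Y1 = mv (Dn 0) Y0"
    have g1: "f (pt X1) = pt Y1" using f1 unfolding flips_def Xs Y1_def by simp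
    have lY1: "fst Y1 = 20" using lY0 unfolding Y1_def by (simp add: fst_mv)
    obtain t2 where f2: "flips X1 Y1 (Up j) t2"
      using step[OF _ _ g1, of "Dn 0" "Up 0" "Up j"] return[OF _ _ f0(1) f1] lX lY0 lY1 k0 j
      unfolding Xs(1)[symmetric] Y1_def[symmetric] by auto
    then obtain b where t2: "t2 = Dn b" unfolding flips_def by (cases t2) auto
    define Y2 where "Y2 = mv t2 Y1"
    have g2: "f (pt X2) = pt Y2" using f2 unfolding flips_def Xs(2) Y2_def by simp
    have lY2: "fst Y2 = 19" using lY1 unfolding Y2_def t2 by (simp add: fst_mv)
    obtain t3 where f3: "flips X2 Y2 (Dn 0) t3"
      using step[OF _ _ g2, of "Dn j" "opp t2" "Dn 0"] return[OF _ _ g1 f2] lX lY1 lY2 k0 j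
      unfolding Xs(2)[symmetric] Y2_def[symmetric] by auto
    then obtain c where t3: "t3 = Up c" unfolding flips_def by (cases t3) auto
    define Y3 where "Y3 = mv t3 Y2"
    have g3: "f (pt X3) = pt Y3" using f3 unfolding flips_def Xs(3) Y3_def by simp
    have lY3: "fst Y3 = 20" using lY2 unfolding Y3_def t3 by (simp add: fst_mv)
    obtain t4 where f4: "flips X3 Y3 (Dn j) t4"
      using step[OF _ _ g3, of "Up 0" "opp t3" "Dn j"] return[OF _ _ g2 f3] lX lY2 lY3 k0 j
      unfolding Xs(3)[symmetric] Y3_def[symmetric] by auto
    then obtain d where t4: "t4 = Up d" unfolding flips_def by (cases t4) auto
    define Y4 where "Y4 = mv t4 Y3"
    have g4: "f (pt X4) = pt Y4" using f4 unfolding flips_def Xs(4) Y4_def by simp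
    have lY4: "fst Y4 = 21" using lY3 unfolding Y4_def t4 by (simp add: fst_mv)
    obtain t5 where f5: "flips X4 Y4 (Up 0) t5"
      using step[OF _ _ g4, of "Up j" "opp t4" "Up 0"] return[OF _ _ g3 f4] lX lY3 lY4 k0 j
      unfolding Xs(4)[symmetric] Y4_def[symmetric] by auto
    then obtain e where t5: "t5 = Dn e" unfolding flips_def by (cases t5) auto
    define Y5 where "Y5 = mv t5 Y4"
    have g5: "f (pt X5) = pt Y5" using f5 unfolding flips_def Xs(5) Y5_def by simp
    have lY5: "fst Y5 = 20" using lY4 unfolding Y5_def t5 by (simp add: fst_mv)
    obtain t6 where f6: "flips X5 Y5 (Dn j) t6"
      using step[OF _ _ g5, of "Dn 0" "opp t5" "Dn j"] return[OF _ _ g4 f5] lX lY4 lY5 k0 j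
      unfolding Xs(5)[symmetric] Y5_def[symmetric] by auto
    then obtain g where t6: "t6 = Up g" unfolding flips_def by (cases t6) auto
    have closing: "pt (mv t6 Y5) = pt Y0"
      using f6 X6 f0 unfolding flips_def by simp
    have labs: "b < k" "c < k" "d < k" "e < k" "g < k"
      using f2 f3 f4 f5 f6 unfolding flips_def t2 t3 t4 t5 t6 by auto
    \<comment> \<open>Read from its third step this is UUDUDD; lowering the start from 21 to 2 puts
      its lowest level at 0.\<close>
    let ?ws = "[Dn 0, Dn b, Up c, Up d, Dn e, Up g]"
    have "pt (fold mv ?ws (fst Y0, snd Y0)) = pt (fst Y0, snd Y0)"
      using closing unfolding Y5_def Y4_def Y3_def Y2_def Y1_def t2 t3 t4 t5 t6 by simp
    then have "closed 21 ?ws"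
      using pt_fold_mv_iff[of 21 ?ws "snd Y0"] labs k0 lY0 by simp
    then have "closed 2 ?ws"
      using closed_shift[of 2 ?ws 19] by simp
    moreover have eq: "disp 2 ?ws i = (if c = i then 1 else 0) + (if d = i then 2 else 0) - (if e = i then 2 else 0)
      + (if g = i then 2 else 0) - (if 0 = i then 2 else 0) - (if b = i then 1 else 0)" for i
      by simp
    ultimately have D: "int n dvd (if c = i then 1 else 0) + (if d = i then 2 else 0) - (if e = i then 2 else 0)
      + (if g = i then 2 else 0) - (if 0 = i then 2 else 0) - (if b = i then 1 else 0)" if "i \<in> {c, d, e, g, 0, b}" for i
      using that labs k0 unfolding closed_def eq by blast
    have bc: "b \<noteq> c"
      using turn[OF _ _ g1 _ _ f2 f3[unfolded Xs(2) Y2_def]] lX lY1 k0 j unfolding t2 t3 by auto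
    have de: "d \<noteq> e"
      using turn[OF _ _ g3 _ _ f4 f5[unfolded Xs(4) Y4_def]] lX lY3 k0 j unfolding t4 t5 by auto
    have eg: "e \<noteq> g"
      using turn[OF _ _ g4 _ _ f5 f6[unfolded Xs(5) Y5_def]] lX lY4 k0 j unfolding t5 t6 by auto
    \<comment> \<open>The image does not backtrack at its base point either, since \<open>X5\<close>
      and \<open>X1\<close> are distinct neighbours of \<open>X0\<close>.\<close>
    have g0: "g \<noteq> 0"
    proof
      assume "g = 0"
      have "Y5 = mv (Dn g) (mv (Up g) Y5)" using mv_opp[of Y5 "Up g"] lY5 by simp
      then have "pt Y5 = pt (mv (Dn g) Y0)"
        using pt_mv_cong[of "mv (Up g) Y5" Y0 "Dn g"] closing lY0 lY5 t6 by (simp add: fst_mv)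
      then have "f (pt X5) = f (pt X1)" using g5 g1 \<open>g = 0\<close> unfolding Y1_def by simp
      then have "pt X5 = pt X1" using graph_automorphism_inj[OF f] by simp
      moreover have "X5 = mv (Up j) X0" using mv_opp[of X5 "Dn j"] X6 lX by simp
      ultimately show False using pt_mv_inj[of "Up j" X0 "Up 0"] Xs(1) lX j k0 by simp
    qed
    have r: "n = 5 \<and> d = c \<and> g = c \<and> 0 = e \<and> b = e"
      using closed_UUDUDD[OF D n5 n_odd de eg g0 bc] by simp
    then have "t2 = Dn 0" using t2 by simp
    then have "f (pt X2) = pt (mv (Dn 0) (mv (Dn 0) Y0))" using g2 unfolding Y2_def Y1_def by simp
    then show ?thesis using r unfolding Xs by blast
  qed
  have "n = 5" using main[of 1] k0 by simp
  then have "2 < k" using kn by simp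
  then have "f (pt (mv (Up 1) (mv (Up 0) X0))) = f (pt (mv (Up 2) (mv (Up 0) X0)))"
    using main[of 1, THEN conjunct2] main[of 2, THEN conjunct2] by simp
  then have "pt (mv (Up 1) (mv (Up 0) X0)) = pt (mv (Up 2) (mv (Up 0) X0))"
    using graph_automorphism_inj[OF f] by simp
  then have "Up 1 = Up 2"
    by (rule pt_mv_inj) (use \<open>2 < k\<close> in \<open>auto simp: fst_mv\<close>)
  then show False by simp
qed

lemma not_arc_transitive_cases:
  assumes n: "n \<noteq> 3" and k2: "k = 2 \<Longrightarrow> n \<noteq> 5 \<and> \<not> (n = 7 \<and> (m = 3 \<or> m = 6)) \<and> \<not> (m = 6 \<and> (n = 9 \<or> n = 21))"
  shows "\<not> arc_transitive V E"
proof -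
  have n5: "5 \<le> n"
  proof -
    have "n \<noteq> 2" "n \<noteq> 4" using n_odd by auto
    then show ?thesis using bouwer_axioms n unfolding bouwer_def by linarith
  qed
  have "n \<noteq> 6" "n \<noteq> 8" using n_odd by auto
  then consider "n = 5" | "n = 7" | "9 \<le> n" "\<not> (m = 6 \<and> n = 9)" | "m = 6" "n = 9"
    using n5 by linarith
  then show ?thesis
  proof cases
    case 1
    then have "2 < k" using k2 k by (cases "k = 2") auto
    then show ?thesis
      using card_ends_source_sink_5 card_ends_UU_5 1 n5
      by (intro not_arc_transitive[of "{..<2 * k - 1}"]) (auto simp: not_less)
  next
    case 2
    then have km: "2 < k \<or> m \<noteq> 3 \<and> m \<noteq> 6" using k2 k by (cases "k = 2") auto
    show ?thesis
    proof (intro not_arc_transitive[of "{..<k + 1}"])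
      show "2 < k \<or> (\<forall>i<k. card (ends (Up i) (Up i)) \<in> {..<k + 1})"
        using card_ends_UU_straight_7 2 km by (simp del: less_Suc_eq) blast
    next
      fix i j assume "i < k" "j < k" "i \<noteq> j"
      then show "card (ends (Up i) (Dn j)) \<notin> {..<k + 1} \<and> card (ends (Dn i) (Up j)) \<notin> {..<k + 1}"
        using card_ends_source_sink_7[of i j] 2 by auto
      show "card (ends (Up i) (Up j)) \<in> {..<k + 1}"
        using card_ends_UU_7[OF 2 \<open>i \<noteq> j\<close> km] by simp
    qed (use 2 in auto)
  next
    case 3
    then have km: "2 < k \<or> \<not> (m = 6 \<and> n = 21)" using k2 k by (cases "k = 2") auto
    show ?thesis
    proof (intro not_arc_transitive[of "{..<k}"])
      fix i j assume "i < k" "j < k" "i \<noteq> j"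
      then show "card (ends (Up i) (Dn j)) \<notin> {..<k} \<and> card (ends (Dn i) (Up j)) \<notin> {..<k}"
        using card_ends_source_sink[of i j] by auto
    qed (use card_ends_UU_ge9[OF 3 km] 3 in auto)
  next
    case 4
    then have "2 < k" using k2 k by (cases "k = 2") auto
    \<comment> \<open>The counts of directed paths are now the larger ones, so \<open>T\<close> is
      an upper set.\<close>
    show ?thesis
    proof (intro not_arc_transitive[of "{k<..}"])
      fix i j assume "i < k" "j < k" "i \<noteq> j"
      then show "card (ends (Up i) (Dn j)) \<notin> {k<..} \<and> card (ends (Dn i) (Up j)) \<notin> {k<..}"
        using card_ends_source_sink_9[of i j] 4 by (auto simp: not_less)
      show "card (ends (Up i) (Up j)) \<in> {k<..}"
        using card_ends_UU_9[of i j] 4 \<open>i < k\<close> \<open>j < k\<close> \<open>i \<noteq> j\<close> by simp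
    qed (use \<open>2 < k\<close> 4 in auto)
  qed
qed

end

section \<open>The arc-transitive cases\<close>

lemma three_dvd_pow2_sum:
  assumes "odd (A + C)"
  shows "(3 :: int) dvd 2 ^ A + 2 ^ C"
proof -
  have p: "[2 ^ B = (-1) ^ B] (mod (3::int))" for B :: nat
    by (intro cong_pow) (simp add: cong_def)
  have "[2 ^ A + 2 ^ C = (-1) ^ A + (-1) ^ C] (mod (3::int))"
    by (intro cong_add p)
  moreover have "(-1) ^ A + (-1) ^ C = (0::int)"
    using assms by (cases "even A") auto
  ultimately show ?thesis by (simp add: cong_0_iff)
qed

context bouwer
begin

text \<open>Negating the level and keeping the vector reverses every edge: modulo 3, 2 is -1 and
  \<open>m\<close> is even, so 2^a and 2^(-a-1) are opposite.\<close>

lemma arc_transitive_3: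
  assumes n3: "n = 3"
  shows "arc_transitive V E"
proof -
  have m_even: "even m"
  proof (rule ccontr)
    assume "odd m"
    then have "(3::int) dvd 2 ^ m + 2 ^ 0" by (intro three_dvd_pow2_sum) simp
    moreover have "[2 ^ m = 2 ^ 0] (mod int n)" by (intro pow_mod_level) simp
    then have "(3::int) dvd 2 ^ m - 2 ^ 0" unfolding n3 by (simp add: cong_iff_dvd_diff)
    ultimately have "(3::int) dvd (2 ^ m + 2 ^ 0) - (2 ^ m - 2 ^ 0)" by (rule dvd_diff)
    then show False by simp
  qed
  \<comment> \<open>Multiplication by \<open>m - 1\<close> is negation modulo \<open>m\<close>
    within the natural numbers.\<close>
  define f where "f v = ((fst v * (m - 1)) mod m, snd v)" for v :: "nat \<times> (nat \<Rightarrow> nat)"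
  have f_pt: "f (pt (A, \<beta>)) = pt (A * (m - 1), \<beta>)" for A \<beta>
    unfolding f_def pt.simps by (simp add: mod_mult_left_eq)
  have rev: "f (pt (A, \<beta>)) = pt (mv (Up l) (Suc A * (m - 1), snd (mv (Up l) (A, \<beta>))))" for A \<beta> l
    unfolding f_pt mv.simps snd_conv
  proof (rule pt_cong)
    have "Suc (Suc A * (m - 1)) = A * (m - 1) + m" using m by simp
    then show "A * (m - 1) mod m = Suc (Suc A * (m - 1)) mod m" by simp
    fix i
    have "odd (A + Suc A * (m - 1))" using m_even m by auto
    then have "(3::int) dvd 2 ^ A + 2 ^ (Suc A * (m - 1))" by (rule three_dvd_pow2_sum)
    then show "[\<beta> i = \<beta> i + (if l = i then 2 ^ A else 0) + (if l = i then 2 ^ (Suc A * (m - 1)) else 0)] (mod int n)"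
      unfolding n3 by (subst cong_sym_eq) (auto simp: cong_iff_dvd_diff)
  qed
  have aut: "graph_automorphism V E f"
  proof (rule graph_automorphismI[OF finite_V E_sub])
    show "f ` V \<subseteq> V"
      unfolding f_def bouwer_vertices_def using m by auto
    show "inj_on f V"
    proof (rule inj_onI)
      fix u v assume "u \<in> V" "v \<in> V" and eq: "f u = f v"
      then have lt: "fst u < m" "fst v < m" unfolding bouwer_vertices_def by auto
      have "[fst u * (m - 1) = fst v * (m - 1)] (mod m)" using eq unfolding f_def cong_def by simp
      moreover have "coprime (m - 1) m" using m by (intro coprime_diff_one_left_nat) simp
      ultimately have "[fst u = fst v] (mod m)" by (simp add: cong_mult_rcancel_nat)
      then have "fst u = fst v" using lt by (simp add: cong_def)
      then show "u = v" using eq unfolding f_def by (simp add: prod_eq_iff)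
    qed
    fix e assume "e \<in> E"
    then obtain A \<beta> l where e: "e = {pt (A, \<beta>), pt (mv (Up l) (A, \<beta>))}" "l < k"
      by (rule edge_lift)
    have "f (pt (mv (Up l) (A, \<beta>))) = pt (Suc A * (m - 1), snd (mv (Up l) (A, \<beta>)))"
      unfolding mv.simps f_pt by simp
    then show "f ` e \<in> E"
      unfolding e using edge_up[OF e(2)] rev[of A \<beta> l] by (simp add: insert_commute del: mv.simps)
  qed
  show ?thesis
  proof (rule arc_transitiveI[OF aut])
    show "f (pt (1, \<lambda>_. 0)) = pt (mv (Up 0) (Suc 1 * (m - 1), snd (mv (Up 0) (1, \<lambda>_. 0))))"
      by (rule rev)
    show "f (pt (mv (Up 0) (1, \<lambda>_. 0))) = pt (Suc 1 * (m - 1), snd (mv (Up 0) (1, \<lambda>_. 0)))"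
      unfolding mv.simps f_pt by simp
  qed (use k m in auto)
qed

end

section \<open>The case k = 2: vertices as pairs of numbers\<close>

definition bv :: "nat \<times> nat \<Rightarrow> nat \<times> (nat \<Rightarrow> nat)" where
  "bv p = (fst p, \<lambda>i\<in>{1..2-1}. snd p)"

definition fwd :: "nat \<Rightarrow> nat \<Rightarrow> nat \<times> nat \<Rightarrow> nat \<times> nat \<Rightarrow> bool" where
  "fwd m n p q \<longleftrightarrow> fst q = (fst p + 1) mod m \<and> (snd q = snd p \<or> snd q = (snd p + 2 ^ fst p) mod n)"

lemma bv_inj [simp]: "bv p = bv q \<longleftrightarrow> p = q"
proof
  assume "bv p = bv q"
  then have "fst (bv p) = fst (bv q)" "snd (bv p) 1 = snd (bv q) 1" by simp_all
  then show "p = q" by (simp add: bv_def prod_eq_iff)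
qed simp

lemma bouwer_vertices_2: "bouwer_vertices 2 m n = bv ` ({..<m} \<times> {..<n})"
proof (intro set_eqI iffI)
  fix v assume "v \<in> bouwer_vertices 2 m n"
  then obtain a b where v: "v = (a, b)" "a < m" "b \<in> {1..2-1} \<rightarrow>\<^sub>E {0..<n}"
    unfolding bouwer_vertices_def by auto
  have hb: "b = (\<lambda>i\<in>{1..2-1}. b 1)"
    using v(3) by (auto simp: fun_eq_iff restrict_def PiE_def extensional_def)
  have "v = bv (a, b 1)"
    unfolding v(1) bv_def fst_conv snd_conv by (subst hb[symmetric]) (rule refl)
  moreover have "(a, b 1) \<in> {..<m} \<times> {..<n}" using PiE_mem[OF v(3), of 1] v(2) by simp
  ultimately show "v \<in> bv ` ({..<m} \<times> {..<n})" by (rule image_eqI)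
next
  fix v assume "v \<in> bv ` ({..<m} \<times> {..<n})"
  then obtain p where "v = bv p" "fst p < m" "snd p < n" by auto
  then show "v \<in> bouwer_vertices 2 m n"
    unfolding bouwer_vertices_def bv_def by simp
qed

lemma bouwer_edges_2:
  "e \<in> bouwer_edges 2 m n \<longleftrightarrow>
    (\<exists>p\<in>{..<m} \<times> {..<n}. \<exists>q. fwd m n p q \<and> e = {bv p, bv q})"
proof
  assume "e \<in> bouwer_edges 2 m n"
  then obtain a b c where e: "e = {(a, b), ((a + 1) mod m, c)}" "(a, b) \<in> bouwer_vertices 2 m n"
    "c = b \<or> (\<exists>j\<in>{1..2-1}. c = (\<lambda>i\<in>{1..2-1}. (b i + 2 ^ a * unit_vector j i) mod n))"
    unfolding bouwer_edges_def by blast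
  obtain b0 where b0: "(a, b) = bv (a, b0)" "a < m" "b0 < n"
    using e(2) unfolding bouwer_vertices_2 by (auto simp: bv_def)
  then have b: "b = (\<lambda>i\<in>{1..2-1}. b0)" unfolding bv_def by simp
  have "((a + 1) mod m, c) = bv ((a + 1) mod m, b0) \<or> ((a + 1) mod m, c) = bv ((a + 1) mod m, (b0 + 2 ^ a) mod n)"
    using e(3) unfolding b bv_def by (auto simp: unit_vector_def fun_eq_iff restrict_def)
  then show "\<exists>p\<in>{..<m} \<times> {..<n}. \<exists>q. fwd m n p q \<and> e = {bv p, bv q}"
    unfolding e(1) b0(1) fwd_def using b0 by (intro bexI[of _ "(a, b0)"]) auto
next
  assume "\<exists>p\<in>{..<m} \<times> {..<n}. \<exists>q. fwd m n p q \<and> e = {bv p, bv q}"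
  then obtain a b a' c where p: "a < m" "b < n" "fwd m n (a, b) (a', c)" "e = {bv (a, b), bv (a', c)}"
    by auto
  have v: "bv (a, b) \<in> bouwer_vertices 2 m n" unfolding bouwer_vertices_2 using p by blast
  let ?b = "\<lambda>i\<in>{1..2-1::nat}. b" and ?c = "\<lambda>i\<in>{1..2-1::nat}. c"
  have "?c = ?b \<or> (\<exists>j\<in>{1..2-1}. ?c = (\<lambda>i\<in>{1..2-1}. (?b i + 2 ^ a * unit_vector j i) mod n))"
    using p(3) unfolding fwd_def by (auto simp: unit_vector_def fun_eq_iff restrict_def)
  then show "e \<in> bouwer_edges 2 m n"
    unfolding bouwer_edges_def mem_Collect_eq p(4) using v p(3)
    by (intro exI[of _ a] exI[of _ ?b] exI[of _ ?c] conjI) (auto simp: bv_def fwd_def)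
qed

text \<open>The arc from (0, 0) to (1, 0) goes to the backward arc from level \<open>B + 1\<close>
  to \<open>B\<close>. By finiteness, injectivity and preservation of edges suffice.\<close>

lemma (in bouwer) arc_transitive_2I:
  assumes k2: "k = 2"
    and grid: "\<And>p. p \<in> {..<m} \<times> {..<n} \<Longrightarrow> g p \<in> {..<m} \<times> {..<n}"
    and inj: "inj_on g ({..<m} \<times> {..<n})"
    and pres: "\<And>p q. p \<in> {..<m} \<times> {..<n} \<Longrightarrow> fwd m n p q \<Longrightarrow> fwd m n (g p) (g q) \<or> fwd m n (g q) (g p)"
    and rev: "g (0, 0) = ((B + 1) mod m, 0)" "g (1, 0) = (B, 0)" "B < m"
  shows "arc_transitive V E"
proof -
  define f where "f v = bv (g (fst v, snd v 1))" for v :: "nat \<times> (nat \<Rightarrow> nat)"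
  have f_bv: "f (bv p) = bv (g p)" for p
    unfolding f_def bv_def by simp
  have q_grid: "q \<in> {..<m} \<times> {..<n}" if "p \<in> {..<m} \<times> {..<n}" "fwd m n p q" for p q
    using that n m unfolding fwd_def by (cases q) auto
  have aut: "graph_automorphism V E f"
  proof (rule graph_automorphismI[OF finite_V E_sub])
    show "f ` V \<subseteq> V" using grid unfolding k2 bouwer_vertices_2 by (auto simp: f_bv)
    show "inj_on f V"
      using inj unfolding k2 bouwer_vertices_2 by (auto simp: inj_on_def f_bv)
    fix e assume "e \<in> E"
    then obtain p q where e: "p \<in> {..<m} \<times> {..<n}" "fwd m n p q" "e = {bv p, bv q}"
      unfolding k2 bouwer_edges_2 by blast
    have "f ` e = {bv (g p), bv (g q)}" unfolding e(3) by (simp add: f_bv)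
    moreover have gpq: "g p \<in> {..<m} \<times> {..<n}" "g q \<in> {..<m} \<times> {..<n}"
      using grid e(1) q_grid[OF e(1,2)] by blast+
    have "{bv (g p), bv (g q)} \<in> E"
      using pres[OF e(1,2)]
    proof
      assume "fwd m n (g p) (g q)"
      then show ?thesis unfolding k2 bouwer_edges_2 using gpq(1) by (intro bexI[of _ "g p"] exI[of _ "g q"] conjI refl)
    next
      assume "fwd m n (g q) (g p)"
      then have "{bv (g q), bv (g p)} \<in> E" unfolding k2 bouwer_edges_2 using gpq(2)
        by (intro bexI[of _ "g q"] exI[of _ "g p"] conjI refl)
      then show ?thesis by (simp only: insert_commute)
    qed
    ultimately show "f ` e \<in> E" by simp
  qed
  have pt_bv: "pt (A, \<beta>) = bv (A mod m, 0)" if "\<beta> 1 = 0" for A \<beta>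
  proof -
    have "nat (\<beta> i mod int n) = 0" if "i \<in> {1..2-1}" for i
    proof -
      have "i = 1" using that by simp
      then show ?thesis using \<open>\<beta> 1 = 0\<close> by simp
    qed
    then have "(\<lambda>i\<in>{1..2-1}. nat (\<beta> i mod int n)) = (\<lambda>i\<in>{1..2-1}. 0)"
      by (rule restrict_ext)
    then show ?thesis unfolding pt.simps bv_def unfolding k2 by simp
  qed
  show ?thesis
  proof (rule arc_transitiveI[OF aut])
    \<comment> \<open>Level \<open>m\<close> represents level 0, because the criterion asks for
      positive lifts.\<close>
    show "f (pt (m, \<lambda>_. 0)) = pt (mv (Up 0) (B + m, \<lambda>_. 0))"
      using rev mod_add_self2[of "Suc B" m] by (simp add: pt_bv f_bv)
    show "f (pt (mv (Up 0) (m, \<lambda>_. 0))) = pt (B + m, \<lambda>_. 0)"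
      using rev m by (simp add: pt_bv f_bv mod_Suc)
  qed (use k m in auto)
qed

lemma (in bouwer) arc_transitive_2_5:
  assumes kn: "k = 2" "n = 5"
  shows "arc_transitive V E"
proof -
  have p4: "2 ^ A mod 5 = [1, 2, 4, 3 :: nat] ! (A mod 4)" for A :: nat
  proof -
    have "[(2 ^ 4) ^ (A div 4) * 2 ^ (A mod 4) = 1 ^ (A div 4) * 2 ^ (A mod 4)] (mod (5::nat))"
      by (intro cong_mult cong_pow cong_refl) (simp add: cong_def)
    moreover have "(2 ^ 4) ^ (A div 4) * 2 ^ (A mod 4) = (2::nat) ^ A"
      by (metis mult_div_mod_eq power_add power_mult)
    ultimately have 1: "(2::nat) ^ A mod 5 = 2 ^ (A mod 4) mod 5" by (simp add: cong_def)
    have "A mod 4 = 0 \<or> A mod 4 = 1 \<or> A mod 4 = 2 \<or> A mod 4 = 3" by presburger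
    then show ?thesis unfolding 1 by auto
  qed
  have "2 ^ m mod 5 = (1::nat)" using pow unfolding kn cong_def by simp
  then have m4: "m mod 4 = 0"
    using p4[of m] by (cases "m mod 4 = 0"; cases "m mod 4 = 1"; cases "m mod 4 = 2"; cases "m mod 4 = 3") auto
  \<comment> \<open>The level is negated. Modulo 5, the change -2 * 2^a equals 2^(-a-1) for even a
    and its negative for odd a; in the odd case the offset changes by 2^(-a-1), which exchanges the
    two edges.\<close>
  define g where "g p = ((m - fst p) mod m, (2 * snd p + (if fst p mod 4 < 2 then 0 else 1)) mod 5)" for p :: "nat \<times> nat"
  have b5: "b = 0 \<or> b = 1 \<or> b = 2 \<or> b = 3 \<or> b = 4" if "b < 5" for b :: nat
    using that by linarith
  show ?thesis
  proof (rule arc_transitive_2I[OF kn(1), of g "m - 1"])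
    show "g p \<in> {..<m} \<times> {..<n}" if "p \<in> {..<m} \<times> {..<n}" for p
      using m unfolding g_def kn by simp
    show "inj_on g ({..<m} \<times> {..<n})"
    proof (rule inj_onI)
      fix p q assume pq: "p \<in> {..<m} \<times> {..<n}" "q \<in> {..<m} \<times> {..<n}" "g p = g q"
      then have "(m - fst p) mod m = (m - fst q) mod m" unfolding g_def by simp
      then have a: "fst p = fst q"
        using pq(1,2) m by (cases "fst p = 0"; cases "fst q = 0") auto
      then have "(2 * snd p + (if fst p mod 4 < 2 then 0 else 1)) mod 5 = (2 * snd q + (if fst p mod 4 < 2 then 0 else 1)) mod 5"
        using pq(3) unfolding g_def by simp
      moreover have "snd p < 5" "snd q < 5" using pq unfolding kn by auto
      ultimately have "snd p = snd q" by (auto split: if_splits dest!: b5)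
      then show "p = q" using a by (simp add: prod_eq_iff)
    qed
    show "fwd m n (g p) (g q) \<or> fwd m n (g q) (g p)" if p: "p \<in> {..<m} \<times> {..<n}" "fwd m n p q" for p q
    proof -
      obtain a b where ab: "p = (a, b)" "a < m" "b < 5" using p kn by (cases p) auto
      obtain c where q: "q = ((a + 1) mod m, c)" "c = b \<or> c = (b + 2 ^ a) mod 5"
        using p(2) unfolding ab fwd_def kn by (cases q) auto
      define a' where "a' = (a + 1) mod m"
      have a'4: "a' mod 4 = (a + 1) mod 4"
        unfolding a'_def using m4 by (metis mod_mod_cancel mod_0_imp_dvd)
      \<comment> \<open>The image of \<open>q\<close> lies at level -(a + 1), one below the image of
        \<open>p\<close>, so every edge is reversed.\<close>
      define d where "d = (m - a') mod m"
      have d: "(m - a) mod m = (d + 1) mod m"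
        unfolding d_def a'_def using ab(2) m
        by (cases "a + 1 = m"; cases "a = 0") (auto simp: Suc_diff_Suc mod_Suc)
      have d4: "d mod 4 = (m - a') mod 4"
        unfolding d_def using m4 by (metis mod_mod_cancel mod_0_imp_dvd)
      have "a' < m" unfolding a'_def using m by simp
      then have "(d + a') mod 4 = 0"
        using d4 m4 by (metis add.commute le_add_diff_inverse less_imp_le_nat mod_add_right_eq)
      then have sum4: "(d + a + 1) mod 4 = 0"
        using a'4 by (metis mod_add_right_eq add.assoc)
      have r: "c = b \<or> c = (b + [1, 2, 4, 3] ! (a mod 4)) mod 5"
        using q(2) p4[of a] by (metis mod_add_right_eq)
      have a4: "a mod 4 = 0 \<and> d mod 4 = 3 \<or> a mod 4 = 1 \<and> d mod 4 = 2 \<or> a mod 4 = 2 \<and> d mod 4 = 1 \<or> a mod 4 = 3 \<and> d mod 4 = 0"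
        using sum4 by presburger
      define y where "y = (if a mod 4 < 2 then 0 else 1 :: nat)"
      define y' where "y' = (if (a + 1) mod 4 < 2 then 0 else 1 :: nat)"
      have "(2 * b + y) mod 5 = (2 * c + y') mod 5 \<or>
        (2 * b + y) mod 5 = ((2 * c + y') mod 5 + [1, 2, 4, 3] ! (d mod 4)) mod 5"
        using r a4 b5[OF ab(3)] unfolding y_def y'_def
        by (elim disjE conjE; simp add: mod_Suc)
      then have "(2 * b + y) mod 5 = (2 * c + y') mod 5 \<or>
        (2 * b + y) mod 5 = ((2 * c + y') mod 5 + 2 ^ d) mod 5"
        using p4[of d] by (metis mod_add_right_eq)
      moreover have "g p = ((d + 1) mod m, (2 * b + y) mod 5)"
        unfolding g_def ab y_def fst_conv snd_conv d ..
      moreover have "g q = (d, (2 * c + y') mod 5)"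
        unfolding g_def q(1) a'_def[symmetric] fst_conv snd_conv a'4 d_def y'_def ..
      ultimately have "fwd m n (g q) (g p)"
        unfolding fwd_def kn by simp
      then show ?thesis ..
    qed
  qed (use m m4 in \<open>auto simp: g_def\<close>)
qed

section \<open>The sporadic cases\<close>

text \<open>
  Arc-reversing involutions for \<open>n = 7\<close> and \<open>n = 21\<close>, found by computer search. They permute the
  residues modulo \<open>n\<close> by \<open>\<sigma>\<close>; the permutation for \<open>n = 21\<close> lies over the one for \<open>n = 7\<close> and acts as
  negation modulo 3.
\<close>

definition sigma7 :: "nat list" where
  "sigma7 = [0, 6, 3, 2, 4, 5, 1]"

definition sigma21 :: "nat list" where
  "sigma21 = [0, 20, 10, 9, 11, 19, 15, 14, 13, 3, 2, 4, 12, 8, 7, 6, 17, 16, 18, 5, 1]"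

text \<open>The residue of \<open>b\<close> modulo 7 selects a translation or a reflection of the
  cycle of levels; 1 and 6, which are exchanged, receive inverse translations. The summand
  \<open>m\<close> prevents truncated subtraction.\<close>

fun sporadic :: "nat \<Rightarrow> nat list \<Rightarrow> nat \<times> nat \<Rightarrow> nat \<times> nat" where
  "sporadic m \<sigma> (a, b) =
    ((if b mod 7 = 1 then a + m - 1 else if b mod 7 = 4 then 3 + m - a else if b mod 7 = 5 then a + 3
      else if b mod 7 = 6 then a + 1 else 1 + m - a) mod m, \<sigma> ! b)"

text \<open>Being self-inverse yields injectivity, and edges need testing only at the two forward
  neighbours.\<close>

definition sporadic_check :: "nat \<Rightarrow> nat list \<Rightarrow> bool" where
  "sporadic_check m \<sigma> \<longleftrightarrow> (let n = length \<sigma> in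
     list_all (\<lambda>a. list_all (\<lambda>b. let q = sporadic m \<sigma> (a, b) in
       fst q < m \<and> snd q < n \<and> sporadic m \<sigma> q = (a, b) \<and>
       list_all (\<lambda>c. let r = sporadic m \<sigma> ((a + 1) mod m, c) in fwd m n q r \<or> fwd m n r q)
         [b, (b + 2 ^ a) mod n]) [0..<n]) [0..<m])"

lemma sporadic_checks: "sporadic_check 3 sigma7" "sporadic_check 6 sigma7" "sporadic_check 6 sigma21"
  by code_simp+

lemma (in bouwer) arc_transitive_sporadic:
  assumes k2: "k = 2" and chk: "sporadic_check m \<sigma>" and n: "n = length \<sigma>"
    and s0: "\<sigma> ! 0 = 0"
  shows "arc_transitive V E"
proof -
  have all: "fst (sporadic m \<sigma> (a, b)) < m \<and> snd (sporadic m \<sigma> (a, b)) < n \<and>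
      sporadic m \<sigma> (sporadic m \<sigma> (a, b)) = (a, b) \<and>
      (\<forall>x\<in>set [b, (b + 2 ^ a) mod n].
        fwd m n (sporadic m \<sigma> (a, b)) (sporadic m \<sigma> ((a + 1) mod m, x)) \<or>
        fwd m n (sporadic m \<sigma> ((a + 1) mod m, x)) (sporadic m \<sigma> (a, b)))"
    if "a < m" "b < n" for a b
  proof -
    have "a \<in> set [0..<m]" "b \<in> set [0..<n]" using that by simp_all
    then show ?thesis
      using chk unfolding sporadic_check_def Let_def n[symmetric] list_all_iff by blast
  qed
  show ?thesis
  proof (rule arc_transitive_2I[OF k2, of "sporadic m \<sigma>" 0])
    show "sporadic m \<sigma> p \<in> {..<m} \<times> {..<n}" if "p \<in> {..<m} \<times> {..<n}" for p
      using all[of "fst p" "snd p"] that by (cases p) (simp add: mem_Times_iff del: sporadic.simps)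
    show "inj_on (sporadic m \<sigma>) ({..<m} \<times> {..<n})"
      by (rule inj_on_inverseI[where g = "sporadic m \<sigma>"]) (use all in \<open>auto simp del: sporadic.simps\<close>)
    show "fwd m n (sporadic m \<sigma> p) (sporadic m \<sigma> q) \<or> fwd m n (sporadic m \<sigma> q) (sporadic m \<sigma> p)"
      if "p \<in> {..<m} \<times> {..<n}" "fwd m n p q" for p q
    proof -
      have "q = ((fst p + 1) mod m, snd q)" "snd q \<in> set [snd p, (snd p + 2 ^ fst p) mod n]"
        using that(2) unfolding fwd_def by (auto simp: prod_eq_iff)
      moreover have "fst p < m" "snd p < n" using that(1) by auto
      ultimately show ?thesis using all[of "fst p" "snd p"] by (metis prod.collapse)
    qed
  qed (use m s0 in \<open>auto simp: mod_Suc\<close>)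
qed

section \<open>Walk counts, backtracking allowed, for the exclusion of B(2,6,9)\<close>

fun walks :: "'a set \<Rightarrow> 'a set set \<Rightarrow> nat \<Rightarrow> 'a \<Rightarrow> 'a \<Rightarrow> nat" where
  "walks V E 0 u z = (if z = u then 1 else 0)"
| "walks V E (Suc L) u z = (\<Sum>y\<in>{y\<in>V. {z, y} \<in> E}. walks V E L u y)"

lemma walks_automorphism:
  assumes f: "graph_automorphism V E f" and "u \<in> V"
  shows "z \<in> V \<Longrightarrow> walks V E L (f u) (f z) = walks V E L u z"
proof (induction L arbitrary: z)
  case 0
  then show ?case using assms by (simp add: graph_automorphism_inj)
next
  case (Suc L)
  have "bij_betw f {y\<in>V. {z, y} \<in> E} {y\<in>V. {f z, y} \<in> E}"
    unfolding bij_betw_def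
  proof
    show "inj_on f {y\<in>V. {z, y} \<in> E}"
      using graph_automorphism_inj[OF f] by (auto simp: inj_on_def)
    show "f ` {y\<in>V. {z, y} \<in> E} = {y\<in>V. {f z, y} \<in> E}"
    proof
      show "f ` {y\<in>V. {z, y} \<in> E} \<subseteq> {y\<in>V. {f z, y} \<in> E}"
        using graph_automorphism_edge[OF f Suc.prems] graph_automorphism_in[OF f] by auto
      show "{y\<in>V. {f z, y} \<in> E} \<subseteq> f ` {y\<in>V. {z, y} \<in> E}"
        using graph_automorphism_edge[OF f Suc.prems] graph_automorphism_surj[OF f] by fastforce
    qed
  qed
  then have "walks V E (Suc L) (f u) (f z) = (\<Sum>y\<in>{y\<in>V. {z, y} \<in> E}. walks V E L (f u) (f y))"
    using sum.reindex_bij_betw[of f _ _ "walks V E L (f u)"] by simp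
  also have "\<dots> = walks V E (Suc L) u z"
    using Suc.IH by simp
  finally show ?case .
qed

definition grid69 :: "(nat \<times> nat) list" where
  "grid69 = List.product [0..<6] [0..<9]"

text \<open>The constants 5 and 8 stand for -1 modulo 6 and modulo 9; explicit lists make the counts
  executable.\<close>

fun nbrs69 :: "nat \<times> nat \<Rightarrow> (nat \<times> nat) list" where
  "nbrs69 (a, b) = [((a + 1) mod 6, b), ((a + 1) mod 6, (b + 2 ^ a) mod 9),
     ((a + 5) mod 6, b), ((a + 5) mod 6, (b + 8 * 2 ^ ((a + 5) mod 6)) mod 9)]"

fun walks69 :: "nat \<Rightarrow> nat \<times> nat \<Rightarrow> nat \<times> nat \<Rightarrow> nat" where
  "walks69 0 p q = (if q = p then 1 else 0)"
| "walks69 (Suc L) p q = sum_list (map (walks69 L p) (nbrs69 q))"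

lemma nbrs69_check:
  "list_all (\<lambda>p. distinct (nbrs69 p) \<and> list_all (\<lambda>q. fst q < 6 \<and> snd q < 9) (nbrs69 p) \<and>
     list_all (\<lambda>q. (fwd 6 9 p q \<or> fwd 6 9 q p) = (q \<in> set (nbrs69 p))) grid69) grid69"
  by code_simp

lemma walks69_check:
  "walks69 2 (0, 0) (0, 5) = 1" "walks69 5 (1, 0) (0, 5) = 27"
  "list_all (\<lambda>q. if walks69 2 (1, 0) q = 1 then walks69 5 (0, 0) q \<noteq> 27 else True) grid69"
  by code_simp+

lemma grid69: "set grid69 = {..<6} \<times> {..<9}"
  unfolding grid69_def by auto

lemma nbrs69:
  assumes "p \<in> {..<6} \<times> {..<9}"
  shows "distinct (nbrs69 p)" "set (nbrs69 p) \<subseteq> {..<6} \<times> {..<9}"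
    "{y \<in> bouwer_vertices 2 6 9. {bv p, y} \<in> bouwer_edges 2 6 9} = bv ` set (nbrs69 p)"
proof -
  have chk: "distinct (nbrs69 p)" "\<forall>q\<in>set (nbrs69 p). fst q < 6 \<and> snd q < 9"
    "\<And>q. q \<in> {..<6} \<times> {..<9} \<Longrightarrow> (fwd 6 9 p q \<or> fwd 6 9 q p) = (q \<in> set (nbrs69 p))"
    using nbrs69_check assms unfolding list_all_iff grid69 by blast+
  show "distinct (nbrs69 p)" by (rule chk(1))
  show sub: "set (nbrs69 p) \<subseteq> {..<6} \<times> {..<9}"
    using chk(2) by (simp add: subset_iff mem_Times_iff)
  have edge: "{bv p, bv q} \<in> bouwer_edges 2 6 9 \<longleftrightarrow> fwd 6 9 p q \<or> fwd 6 9 q p"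
    if "q \<in> {..<6} \<times> {..<9}" for q
    unfolding bouwer_edges_2 doubleton_eq_iff bv_inj using assms that by blast
  show "{y \<in> bouwer_vertices 2 6 9. {bv p, y} \<in> bouwer_edges 2 6 9} = bv ` set (nbrs69 p)"
  proof (intro set_eqI iffI)
    fix y assume "y \<in> {y \<in> bouwer_vertices 2 6 9. {bv p, y} \<in> bouwer_edges 2 6 9}"
    then obtain q where q: "y = bv q" "q \<in> {..<6} \<times> {..<9}" "{bv p, bv q} \<in> bouwer_edges 2 6 9"
      unfolding bouwer_vertices_2 by blast
    then show "y \<in> bv ` set (nbrs69 p)" using edge[OF q(2)] chk(3)[OF q(2)] by blast
  next
    fix y assume "y \<in> bv ` set (nbrs69 p)"
    then obtain q where q: "y = bv q" "q \<in> set (nbrs69 p)" by blast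
    then have g: "q \<in> {..<6} \<times> {..<9}" using sub by blast
    then have "{bv p, bv q} \<in> bouwer_edges 2 6 9" using edge[OF g] chk(3)[OF g] q(2) by blast
    then show "y \<in> {y \<in> bouwer_vertices 2 6 9. {bv p, y} \<in> bouwer_edges 2 6 9}"
      unfolding bouwer_vertices_2 q(1) using g by blast
  qed
qed

lemma walks69:
  "q \<in> {..<6} \<times> {..<9} \<Longrightarrow> walks (bouwer_vertices 2 6 9) (bouwer_edges 2 6 9) L (bv p) (bv q) = walks69 L p q"
proof (induction L arbitrary: q)
  case (Suc L)
  note nb = nbrs69[OF Suc.prems]
  have "inj_on bv (set (nbrs69 q))" by (simp add: inj_on_def)
  then have "walks (bouwer_vertices 2 6 9) (bouwer_edges 2 6 9) (Suc L) (bv p) (bv q) =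
    (\<Sum>r\<in>set (nbrs69 q). walks (bouwer_vertices 2 6 9) (bouwer_edges 2 6 9) L (bv p) (bv r))"
    unfolding walks.simps nb(3) by (simp only: sum.reindex comp_def)
  also have "\<dots> = (\<Sum>r\<in>set (nbrs69 q). walks69 L p r)"
    using Suc.IH nb(2) by (intro sum.cong) auto
  also have "\<dots> = walks69 (Suc L) p q"
    unfolding walks69.simps by (rule sum_list_distinct_conv_sum_set[OF nb(1), symmetric])
  finally show ?case .
qed simp

text \<open>
  In \<open>B(2,6,9)\<close> closed walks of length six do not separate the two sides. Counting walks instead, an
  automorphism that swaps \<open>(0,0)\<close> and \<open>(1,0)\<close> would map \<open>(0,5)\<close>, which is joined to them by one walk
  of length two and 27 walks of length five respectively, to a vertex that does not exist.
\<close>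

lemma not_arc_transitive_2_6_9:
  "\<not> arc_transitive (bouwer_vertices 2 6 9) (bouwer_edges 2 6 9)" (is "\<not> arc_transitive ?V ?E")
proof
  assume at: "arc_transitive ?V ?E"
  let ?u = "bv (0, 0)" and ?w = "bv (1, 0)" and ?z = "bv (0, 5)"
  have V: "?u \<in> ?V" "?w \<in> ?V" "?z \<in> ?V"
    unfolding bouwer_vertices_2 by (rule imageI; simp)+
  have "{?u, ?w} \<in> ?E"
    unfolding bouwer_edges_2 by (intro bexI[of _ "(0, 0)"] exI[of _ "(1, 0)"]) (simp_all add: fwd_def)
  then have "(?u, ?w) \<in> arcs ?V ?E" "(?w, ?u) \<in> arcs ?V ?E"
    unfolding arcs_def using V by (simp_all add: insert_commute)
  then obtain f where f: "graph_automorphism ?V ?E f" "f ?u = ?w" "f ?w = ?u"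
    using at unfolding arc_transitive_def by fast
  obtain q where q: "f ?z = bv q" "q \<in> {..<6} \<times> {..<9}"
    using graph_automorphism_in[OF f(1) V(3)] unfolding bouwer_vertices_2 by blast
  have z: "(0, 5) \<in> {..<6::nat} \<times> {..<9::nat}" by simp
  have "walks69 2 (1, 0) q = walks69 2 (0, 0) (0, 5)"
    using walks_automorphism[OF f(1) V(1) V(3), of 2] unfolding f(2) q(1) walks69[OF q(2)] walks69[OF z] .
  moreover have "walks69 5 (0, 0) q = walks69 5 (1, 0) (0, 5)"
    using walks_automorphism[OF f(1) V(2) V(3), of 5] unfolding f(3) q(1) walks69[OF q(2)] walks69[OF z] .
  ultimately show False
    using walks69_check q(2) unfolding list_all_iff grid69 by (metis (no_types, lifting))
qed

theorem theorem1p1: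
  fixes k m n :: nat
  assumes "k > 1" and "m > 1" and "n > 1"
    and "[2 ^ m = 1] (mod n)"
  shows "(arc_transitive (bouwer_vertices k m n) (bouwer_edges k m n) \<longleftrightarrow>
            n = 3 \<or> (k, n) = (2, 5) \<or> (k, m, n) \<in> {(2, 3, 7), (2, 6, 7), (2, 6, 21)})
    \<and> (\<not> (n = 3 \<or> (k, n) = (2, 5) \<or> (k, m, n) \<in> {(2, 3, 7), (2, 6, 7), (2, 6, 21)}) \<longrightarrow>
            half_arc_transitive (bouwer_vertices k m n) (bouwer_edges k m n))
    \<and> (m > 6 \<and> n > 5 \<longrightarrow>
            half_arc_transitive (bouwer_vertices k m n) (bouwer_edges k m n))"
proof -
  interpret bouwer k m n
    using assms by unfold_locales
  let ?exc = "n = 3 \<or> (k, n) = (2, 5) \<or> (k, m, n) \<in> {(2, 3, 7), (2, 6, 7), (2, 6, 21)}"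
  have at: "arc_transitive V E" if ?exc
  proof -
    have "sporadic_check m sigma7 \<and> n = 7 \<or> sporadic_check m sigma21 \<and> n = 21"
      if "(k, m, n) \<in> {(2, 3, 7), (2, 6, 7), (2, 6, 21)}"
      using that sporadic_checks by auto
    moreover have "length sigma7 = 7" "length sigma21 = 21" "sigma7 ! 0 = 0" "sigma21 ! 0 = 0"
      by (simp_all add: sigma7_def sigma21_def)
    ultimately show ?thesis
      using that arc_transitive_3 arc_transitive_2_5 arc_transitive_sporadic[of sigma7]
        arc_transitive_sporadic[of sigma21] by auto
  qed
  have not_at: "\<not> arc_transitive V E" if exc: "\<not> ?exc"
  proof -
    \<comment> \<open>For \<open>m = 2\<close>, \<open>n\<close> divides 3 and the graph is among
      the exceptions, so \<open>bouwer3\<close> is available.\<close>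
    have "m \<noteq> 2"
    proof
      assume "m = 2"
      then have d: "n dvd 3" using n_dvd by simp
      then have "n \<le> 3" by (rule dvd_imp_le) simp
      then have "n = 2 \<or> n = 3" using n by linarith
      then show False using d exc by auto
    qed
    then interpret bouwer3 k m n
      using m by unfold_locales simp
    show ?thesis
    proof (cases "k = 2 \<and> m = 6 \<and> n = 9")
      case True
      then show ?thesis using not_arc_transitive_2_6_9 by simp
    next
      case False
      then show ?thesis using exc by (intro not_arc_transitive_cases) auto
    qed
  qed
  have half: "half_arc_transitive V E" if "\<not> ?exc"
    unfolding half_arc_transitive_def
    using vertex_transitive_bouwer edge_transitive_bouwer not_at[OF that] by blast
  have big: "\<not> ?exc" if "m > 6 \<and> n > 5" using that by auto
  show ?thesis
    using at not_at half half[OF big] by blast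
qed

end
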